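(* Let $q=2^e$ with $q>2$, $A=\mathbb{F}_q[T]$, and let $C$ be the Carlitz module. Let $m,u\in A$ be monic polynomials such that at least one of them has positive degree. Then there exists a Zsigmondy prime for $(u,m)$, except exactly in the following case: $q=4$, $u=1$, and $m=(\wp-1)\wp$, where $\wp$ is an arbitrary monic prime of degree $1$ in $\mathbb{F}_4[T]$.
   Context: $A=\mathbb{F}_q[T]$, $k=\mathbb{F}_q(T)$. The Carlitz module is the $\mathbb{F}_q$-algebra homomorphism $a\mapsto C_a$ from $A$ to the twisted polynomial ring $k\langle\tau\rangle$ (with $\tau(x)=x^q$) determined by $C_T=T+\tau$; thus $C_T(x)=Tx+x^q$ and $C_a(x)\in A[x]$ for every $a\in A$, with $C_{ab}(x)=C_a(C_b(x))$. For nonzero $m,u\in A$, a Zsigmondy prime for $(u,m)$ is a monic prime $\wp\in A$ such that $C_m(u)\equiv 0\pmod{\wp}$ and $C_n(u)\not\equiv 0\pmod{\wp}$ for every nonzero $n\in A$ with $\deg(n)<\deg(m)$. *)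

theory Defs
  imports
    "HOL-Library.Cardinality"
    "HOL-Computational_Algebra.Computational_Algebra"
    "HOL-Number_Theory.Cong"
begin

text \<open>
  A finite field with \<open>q\<close> elements is a type \<open>'a :: finite_field\<close> with \<open>CARD('a) = q\<close>, and
  \<open>A = 'a poly\<close>. The Carlitz module takes values in the twisted polynomials
  \<open>\<Sum> c\<^sub>i \<tau>\<^sup>i\<close> with all \<open>c\<^sub>i\<close> in \<open>A\<close>, a subring of the twisted polynomial ring over the fraction
  field of \<open>A\<close>. Such a twisted polynomial is represented by the element of type \<open>'a poly poly\<close>
  with coefficients \<open>c\<^sub>i\<close>; its ring structure consists of the usual addition and of the
  multiplication below, determined by \<open>\<tau>\<^sup>i c = c\<^bsup>q^i\<^esup> \<tau>\<^sup>i\<close>. The library product \<open>*\<close> in the definition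
  is the commutative one and serves only to shift \<open>map_poly (\<lambda>c. c ^ q ^ i) g\<close> by \<open>\<tau>\<^sup>i\<close> and scale it.
\<close>

definition twisted_mult ::
    "'a::finite_field poly poly \<Rightarrow> 'a poly poly \<Rightarrow> 'a poly poly"  (infixl "\<star>" 70)
  where "f \<star> g =
    (\<Sum>i\<le>degree f. monom (coeff f i) i * map_poly (\<lambda>c. c ^ (CARD('a) ^ i)) g)"

text \<open>The value \<open>f(x)\<close>, where \<open>\<tau>\<close> acts as \<open>x \<mapsto> x\<^sup>q\<close>:\<close>

definition twisted_eval :: "'a::finite_field poly poly \<Rightarrow> 'a poly \<Rightarrow> 'a poly"
  where "twisted_eval f x = (\<Sum>i\<le>degree f. coeff f i * x ^ (CARD('a) ^ i))"

text \<open>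
  \<open>C\<^sub>a = \<Sum> a\<^sub>i C\<^sub>T\<^sup>i\<close> for \<open>a = \<Sum> a\<^sub>i T\<^sup>i\<close>, where \<open>C\<^sub>T = T + \<tau>\<close> is \<open>[:[:0, 1:], 1:]\<close> and its powers are taken
  with respect to \<open>\<star>\<close>. The lemmas \<open>carlitz_*\<close> below show that this is the unique algebra
  homomorphism with that value at \<open>T\<close>.
\<close>

definition carlitz :: "'a::finite_field poly \<Rightarrow> 'a poly poly"
  where "carlitz a =
    (\<Sum>i\<le>degree a. smult [:coeff a i:] (((\<star>) [:[:0, 1:], 1:] ^^ i) 1))"

definition zsigmondy_prime :: "'a::finite_field poly \<Rightarrow> 'a poly \<Rightarrow> 'a poly \<Rightarrow> bool"
  where "zsigmondy_prime u m P \<longleftrightarrow>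
    prime_elem P \<and> lead_coeff P = 1 \<and>
    [twisted_eval (carlitz m) u = 0] (mod P) \<and>
    (\<forall>n. n \<noteq> 0 \<and> degree n < degree m \<longrightarrow> \<not> [twisted_eval (carlitz n) u = 0] (mod P))"


subsection \<open>The Frobenius map\<close>

lemma CARD_gt_1: "CARD('a::finite_field) > 1"
proof -
  have "card {0, 1::'a} \<le> CARD('a)" by (rule card_mono) auto
  thus ?thesis by simp
qed

lemma of_nat_CARD_choose:
  assumes "0 < i" "i < CARD('a::finite_field)"
  shows "of_nat (CARD('a) choose i) = (0::'a)"
proof -
  let ?q = "CARD('a)"
  define p :: "'a poly" where "p = (\<Sum>i\<in>{1..<?q}. monom (of_nat (?q choose i)) i)"
  have "poly p x = 0" for x
  proof -
    have eq: "{..?q} = insert 0 (insert ?q {1..<?q})" using CARD_gt_1[where ?'a='a] by auto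
    have "x + 1 = (x + 1) ^ ?q" by (simp add: finite_field_power_card_eq_same)
    also have "\<dots> = (\<Sum>k\<le>?q. of_nat (?q choose k) * x ^ k * 1 ^ (?q - k))"
      by (rule binomial_ring)
    also have "\<dots> = 1 + x ^ ?q + poly p x"
      using CARD_gt_1[where ?'a='a] by (simp add: eq p_def poly_sum poly_monom)
    finally show ?thesis by (simp add: finite_field_power_card_eq_same)
  qed
  moreover have "degree p < ?q"
    unfolding p_def using CARD_gt_1[where ?'a='a]
    by (intro degree_sum_less) (auto intro: le_less_trans[OF degree_monom_le])
  ultimately have "p = 0"
    using card_poly_roots_bound[of p] by force
  hence "coeff p i = 0" by simp
  moreover have "coeff p i = of_nat (?q choose i)"
    unfolding p_def using assms by (simp add: coeff_sum)
  ultimately show ?thesis by simp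
qed

lemma frobenius_add1:
  fixes x y :: "'a::finite_field poly"
  shows "(x + y) ^ CARD('a) = x ^ CARD('a) + y ^ CARD('a)"
proof -
  let ?q = "CARD('a)"
  have eq: "{..?q} = insert 0 (insert ?q {1..<?q})" using CARD_gt_1[where ?'a='a] by auto
  have 0: "of_nat (?q choose i) = (0::'a poly)" if "i \<in> {1..<?q}" for i
    using that of_nat_CARD_choose[where ?'a='a, of i] by (simp add: of_nat_poly)
  have "(x + y) ^ ?q = (\<Sum>k\<le>?q. of_nat (?q choose k) * x ^ k * y ^ (?q - k))"
    by (rule binomial_ring)
  also have "\<dots> = x ^ ?q + y ^ ?q"
    using CARD_gt_1[where ?'a='a] 0 by (simp add: eq)
  finally show ?thesis .
qed

lemma frobenius_add:
  fixes x y :: "'a::finite_field poly"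
  shows "(x + y) ^ (CARD('a) ^ i) = x ^ (CARD('a) ^ i) + y ^ (CARD('a) ^ i)"
  by (induction i) (simp_all add: power_mult frobenius_add1 mult.commute[of "CARD('a)"])

lemma CARD_power_neq_0 [simp]: "CARD('a::finite_field) ^ i \<noteq> 0"
  using CARD_gt_1[where ?'a='a] by simp

lemma frobenius_0 [simp]: "(0::'a::finite_field poly) ^ (CARD('a) ^ i) = 0"
  by (simp add: power_0_left)

lemma frobenius_sum:
  fixes f :: "'b \<Rightarrow> 'a::finite_field poly"
  shows "(\<Sum>x\<in>S. f x) ^ (CARD('a) ^ i) = (\<Sum>x\<in>S. f x ^ (CARD('a) ^ i))"
  by (induction S rule: infinite_finite_induct) (simp_all add: frobenius_add)

lemma frobenius_const:
  "[:c::'a::finite_field:] ^ (CARD('a) ^ i) = [:c:]"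
  by (simp add: poly_const_pow finite_field_power_card_power_eq_same)


subsection \<open>The ring of twisted polynomials\<close>

lemma poly_monom_induct:
  assumes "\<And>c i. P (monom c i)" and "\<And>f g. P f \<Longrightarrow> P g \<Longrightarrow> P (f + g)"
  shows "P (f::'b::comm_ring_1 poly)"
proof -
  have "P (\<Sum>i\<le>n. monom (coeff f i) i)" for n
    by (induction n) (auto intro: assms)
  thus ?thesis by (metis poly_as_sum_of_monoms)
qed

lemma map_poly_frobenius_add:
  fixes f g :: "'a::finite_field poly poly"
  shows "map_poly (\<lambda>c. c ^ (CARD('a) ^ i)) (f + g) =
    map_poly (\<lambda>c. c ^ (CARD('a) ^ i)) f + map_poly (\<lambda>c. c ^ (CARD('a) ^ i)) g"
  by (rule poly_eqI) (simp add: coeff_map_poly frobenius_add)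

lemma twisted_mult_le:
  fixes f g :: "'a::finite_field poly poly"
  assumes "degree f \<le> n"
  shows "f \<star> g = (\<Sum>i\<le>n. monom (coeff f i) i * map_poly (\<lambda>c. c ^ (CARD('a) ^ i)) g)"
  unfolding twisted_mult_def
  by (rule sum.mono_neutral_left) (use assms in \<open>auto simp: coeff_eq_0\<close>)

lemma twisted_mult_add_left: "(f + g) \<star> h = f \<star> h + g \<star> h"
proof -
  let ?n = "max (degree f) (degree g)"
  show ?thesis
    by (subst (1 2 3) twisted_mult_le[where n = ?n])
       (auto intro: degree_add_le simp flip: add_monom sum.distrib simp: algebra_simps)
qed

lemma twisted_mult_add_right: "f \<star> (g + h) = f \<star> g + f \<star> h"
  unfolding twisted_mult_def
  by (simp add: map_poly_frobenius_add algebra_simps sum.distrib)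

lemma twisted_mult_monom_left:
  fixes g :: "'a::finite_field poly poly"
  shows "monom c i \<star> g = monom c i * map_poly (\<lambda>c. c ^ (CARD('a) ^ i)) g"
proof -
  have "monom c i \<star> g =
      (\<Sum>j\<le>i. monom (coeff (monom c i) j) j * map_poly (\<lambda>c. c ^ (CARD('a) ^ j)) g)"
    by (rule twisted_mult_le) (rule degree_monom_le)
  also have "\<dots> = (\<Sum>j\<in>{i}. monom (coeff (monom c i) j) j * map_poly (\<lambda>c. c ^ (CARD('a) ^ j)) g)"
    by (rule sum.mono_neutral_right) auto
  finally show ?thesis by simp
qed

lemma twisted_mult_monom:
  fixes c d :: "'a::finite_field poly"
  shows "monom c i \<star> monom d j = monom (c * d ^ (CARD('a) ^ i)) (i + j)"
  by (simp add: twisted_mult_monom_left map_poly_monom mult_monom)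

lemma twisted_mult_assoc: "(f \<star> g) \<star> h = f \<star> (g \<star> h)"
proof (induction f rule: poly_monom_induct)
  case (1 c i)
  show ?case
  proof (induction g rule: poly_monom_induct)
    case (1 d j)
    show ?case
    proof (induction h rule: poly_monom_induct)
      case (1 e k)
      show ?case
        by (simp add: twisted_mult_monom power_mult_distrib mult.assoc add.assoc
              power_add mult.commute flip: power_mult)
    qed (simp add: twisted_mult_add_right)
  qed (simp add: twisted_mult_add_right twisted_mult_add_left)
qed (simp add: twisted_mult_add_left)

lemma twisted_mult_1_left [simp]: "1 \<star> f = f"
  using twisted_mult_monom_left[of 1 0 f] by simp

lemma twisted_mult_1_right [simp]: "f \<star> 1 = f"
proof (induction f rule: poly_monom_induct)
  case (1 c i)
  show ?case using twisted_mult_monom[of c i 1 0] by simp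
qed (simp add: twisted_mult_add_left)

lemma twisted_mult_0_left [simp]: "0 \<star> f = 0"
  by (simp add: twisted_mult_def)

lemma twisted_mult_0_right [simp]: "f \<star> 0 = 0"
  by (simp add: twisted_mult_def)

lemma twisted_mult_const_left: "[:c:] \<star> f = smult c f"
  using twisted_mult_monom_left[of c 0 f] by (simp add: monom_0)

text \<open>Constants of the base field are central.\<close>

lemma twisted_mult_const_right: "f \<star> [:[:c:]:] = smult [:c:] f"
proof (induction f rule: poly_monom_induct)
  case (1 d i)
  show ?case using twisted_mult_monom[of d i "[:c:]" 0]
    by (simp add: monom_0 frobenius_const smult_monom mult.commute)
qed (simp add: twisted_mult_add_left smult_add_right)

lemma twisted_mult_smult_left: "smult c f \<star> g = smult c (f \<star> g)"
  by (simp add: twisted_mult_assoc flip: twisted_mult_const_left)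

lemma twisted_mult_smult_right: "f \<star> smult [:c:] g = smult [:c:] (f \<star> g)"
proof -
  have "f \<star> smult [:c:] g = (f \<star> [:[:c:]:]) \<star> g"
    by (simp add: twisted_mult_assoc twisted_mult_const_left)
  thus ?thesis by (simp add: twisted_mult_const_right twisted_mult_smult_left)
qed

lemma twisted_eval_le:
  fixes f :: "'a::finite_field poly poly"
  assumes "degree f \<le> n"
  shows "twisted_eval f x = (\<Sum>i\<le>n. coeff f i * x ^ (CARD('a) ^ i))"
  unfolding twisted_eval_def
  by (rule sum.mono_neutral_left) (use assms in \<open>auto simp: coeff_eq_0\<close>)

lemma twisted_eval_add_left: "twisted_eval (f + g) x = twisted_eval f x + twisted_eval g x"
proof -
  let ?n = "max (degree f) (degree g)"
  show ?thesis
    by (subst (1 2 3) twisted_eval_le[where n = ?n])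
       (auto intro: degree_add_le simp: algebra_simps sum.distrib)
qed

lemma twisted_eval_add_right: "twisted_eval f (x + y) = twisted_eval f x + twisted_eval f y"
  by (simp add: twisted_eval_def frobenius_add algebra_simps sum.distrib)

lemma twisted_eval_monom:
  fixes c :: "'a::finite_field poly"
  shows "twisted_eval (monom c i) x = c * x ^ (CARD('a) ^ i)"
proof -
  have "twisted_eval (monom c i) x = (\<Sum>j\<le>i. coeff (monom c i) j * x ^ (CARD('a) ^ j))"
    by (rule twisted_eval_le) (rule degree_monom_le)
  also have "\<dots> = (\<Sum>j\<in>{i}. coeff (monom c i) j * x ^ (CARD('a) ^ j))"
    by (rule sum.mono_neutral_right) auto
  finally show ?thesis by simp
qed

lemma twisted_eval_mult: "twisted_eval (f \<star> g) x = twisted_eval f (twisted_eval g x)"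
proof (induction f rule: poly_monom_induct)
  case (1 c i)
  show ?case
  proof (induction g rule: poly_monom_induct)
    case (1 d j)
    show ?case
      by (simp add: twisted_mult_monom twisted_eval_monom power_mult_distrib mult.assoc
            power_add mult.commute flip: power_mult)
  qed (simp add: twisted_mult_add_right twisted_eval_add_left twisted_eval_add_right)
qed (simp add: twisted_mult_add_left twisted_eval_add_left)


subsection \<open>The Carlitz module\<close>

lemma carlitz_le:
  assumes "degree a \<le> n"
  shows "carlitz a = (\<Sum>i\<le>n. smult [:coeff a i:] (((\<star>) [:[:0, 1:], 1:] ^^ i) 1))"
  unfolding carlitz_def
  by (rule sum.mono_neutral_left) (use assms in \<open>auto simp: coeff_eq_0\<close>)

lemma carlitz_add: "carlitz (a + b) = carlitz a + carlitz b"
proof -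
  let ?n = "max (degree a) (degree b)"
  have eq: "[:x + y:] = [:x:] + [:y:]" for x y :: 'a by simp
  show ?thesis
    by (subst (1 2 3) carlitz_le[where n = ?n])
       (auto intro: degree_add_le simp: eq smult_add_left sum.distrib simp del: add_pCons)
qed

lemma carlitz_monom: "carlitz (monom c i) = smult [:c:] (((\<star>) [:[:0, 1:], 1:] ^^ i) 1)"
proof -
  let ?g = "\<lambda>j. smult [:coeff (monom c i) j:] (((\<star>) [:[:0, 1:], 1:] ^^ j) 1)"
  have "carlitz (monom c i) = (\<Sum>j\<le>i. ?g j)"
    by (rule carlitz_le) (rule degree_monom_le)
  also have "\<dots> = (\<Sum>j\<in>{i}. ?g j)"
    by (rule sum.mono_neutral_right) auto
  finally show ?thesis by simp
qed

lemma carlitz_const: "carlitz [:c:] = [:[:c:]:]"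
  using carlitz_monom[of c 0] by (simp add: monom_0 one_pCons)

lemma carlitz_T: "carlitz [:0, 1:] = [:[:0, 1:], 1:]"
  using carlitz_monom[of 1 1] by (simp add: monom_altdef flip: one_pCons)

lemma twisted_power_add:
  "((\<star>) f ^^ (i + j)) 1 = ((\<star>) f ^^ i) 1 \<star> ((\<star>) f ^^ j) 1"
  by (induction i) (simp_all add: twisted_mult_assoc)

lemma carlitz_mult: "carlitz (a * b) = carlitz a \<star> carlitz b"
proof (induction a rule: poly_monom_induct)
  case (1 c i)
  show ?case
  proof (induction b rule: poly_monom_induct)
    case (1 d j)
    show ?case
      by (simp add: mult_monom carlitz_monom twisted_power_add twisted_mult_smult_left
            twisted_mult_smult_right mult.commute)
  qed (simp add: ring_distribs carlitz_add twisted_mult_add_right)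
qed (simp add: ring_distribs carlitz_add twisted_mult_add_left)

lemma carlitz_unique:
  fixes D :: "'a::finite_field poly \<Rightarrow> 'a poly poly"
  assumes "\<And>a b. D (a + b) = D a + D b" "\<And>a b. D (a * b) = D a \<star> D b"
    and "\<And>c. D [:c:] = [:[:c:]:]" "D [:0, 1:] = [:[:0, 1:], 1:]"
  shows "D = carlitz"
proof
  have 1: "D (monom c i) = carlitz (monom c i)" for c i
  proof (induction i)
    case (Suc i)
    have "monom c (Suc i) = [:0, 1:] * monom c i" by (simp add: monom_Suc)
    thus ?case using Suc by (simp only: assms carlitz_mult carlitz_T)
  qed (simp add: monom_0 assms carlitz_const)
  show "D a = carlitz a" for a
    by (induction a rule: poly_monom_induct) (simp_all add: 1 assms(1) carlitz_add)
qed

lemma twisted_eval_carlitz_T: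
  "twisted_eval (carlitz [:0, 1:]) (x :: 'a::finite_field poly) = [:0, 1:] * x + x ^ CARD('a)"
  by (simp add: carlitz_T twisted_eval_def)

end

theory Submission
  imports Defs
begin

text \<open>
  If there is no Zsigmondy prime, every prime dividing \<open>C\<^sub>m(u)\<close> divides \<open>C\<^bsub>m/p\<^esub>(u)\<close> for some prime
  \<open>p | m\<close>. Let \<open>L\<close> be the least common multiple of these values. Since \<open>C\<^sub>p(y)\<close> has the same
  \<open>P\<close>-adic valuation as \<open>y\<close> for primes \<open>P \<noteq> p\<close> dividing \<open>y\<close>, and a valuation larger by exactly one
  for \<open>P = p\<close>, the quotient \<open>C\<^sub>m(u) / L\<close> (the value at \<open>u\<close> of the Carlitz analogue of a cyclotomic
  polynomial) divides the product of the primes \<open>P\<close> for which \<open>m = P\<^sup>j n\<close> with \<open>n\<close> the order of \<open>u\<close>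
  modulo \<open>P\<close>. As \<open>n\<close> divides \<open>P - 1\<close>, there is at most one such prime, unless \<open>m = P (P - 1)\<close>.
  The degree of \<open>C\<^sub>m(u) / L\<close>, which is \<open>\<phi>(m) deg u\<close> or about \<open>\<phi>(m) / q\<close> if \<open>u = 1\<close>, is too large
  for this, except in the case listed.
\<close>

subsection \<open>Polynomials over a field\<close>

text \<open>The Euclidean algorithm; \<open>g\<close> is a gcd, determined only up to a
  unit.\<close>

lemma poly_bezout:
  fixes a b :: "'a::field poly"
  obtains g x y where "g dvd a" "g dvd b" "g = x * a + y * b"
proof -
  have "\<exists>g x y. g dvd a \<and> g dvd b \<and> g = x * a + y * b"
  \<comment> \<open>The measure ranks the zero polynomial strictly below nonzero constants, which
    the degree alone cannot separate.\<close>
  proof (induction "if b = 0 then 0 else Suc (degree b)" arbitrary: a b rule: less_induct)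
    case less
    show ?case
    proof (cases "b = 0")
      case True
      thus ?thesis by (intro exI[of _ a] exI[of _ 1] exI[of _ 0]) auto
    next
      case False
      have "(if a mod b = 0 then 0 else Suc (degree (a mod b))) < (if b = 0 then 0 else Suc (degree b))"
        using False degree_mod_less[of b a] by auto
      from less[OF this] obtain g x y where g: "g dvd b" "g dvd a mod b" "g = x * b + y * (a mod b)"
        by blast
      have "g dvd a" using g(1,2) by (simp add: dvd_mod_iff)
      moreover have "g = y * a + (x - y * (a div b)) * b"
      proof -
        have "a mod b = a - (a div b) * b" by (simp add: minus_div_mult_eq_mod)
        show ?thesis unfolding g(3) \<open>a mod b = _\<close> by (simp add: algebra_simps)
      qed
      ultimately show ?thesis using g(1) by blast
    qed
  qed
  thus thesis using that by blast
qed

lemma exists_prime_elem_dvd: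
  fixes a :: "'a::field poly"
  assumes "degree a > 0"
  obtains P where "prime_elem P" "P dvd a"
proof -
  from assms have a0: "a \<noteq> 0" by auto
  obtain A where A: "prod_mset A = smult (inverse (lead_coeff a)) a" "\<And>p. p \<in># A \<Longrightarrow> prime_elem p"
    using field_poly_prod_mset_prime_factorization[OF a0] field_poly_in_prime_factorization_imp_prime
    by blast
  have "A \<noteq> {#}"
  proof
    assume "A = {#}"
    hence "degree (smult (inverse (lead_coeff a)) a) = 0" using A(1) by (metis degree_1 prod_mset_empty)
    thus False using assms a0 by simp
  qed
  then obtain p where p: "p \<in># A" by auto
  hence "p dvd smult (inverse (lead_coeff a)) a" using A(1) dvd_prod_mset by metis
  hence "p dvd a" using a0 by (simp add: dvd_smult_iff)
  with A(2) p that show thesis by blast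
qed

definition monic_prime :: "'a::field poly \<Rightarrow> bool"
  where "monic_prime P \<longleftrightarrow> prime_elem P \<and> lead_coeff P = 1"

lemma monic_primeD:
  assumes "monic_prime P"
  shows "prime_elem P" "lead_coeff P = 1" "degree P > 0" "P \<noteq> 0" "\<not> is_unit P"
proof -
  show *: "prime_elem P" "lead_coeff P = 1" "P \<noteq> 0" "\<not> is_unit P"
    using assms by (auto simp: monic_prime_def)
  show "degree P > 0" using *(3,4) by (simp add: is_unit_iff_degree)
qed

lemma monic_prime_normalize:
  fixes P :: "'a::field poly"
  assumes "prime_elem P"
  shows "monic_prime (smult (inverse (lead_coeff P)) P)"
proof -
  have "P \<noteq> 0" using assms by auto
  moreover from this have "is_unit [:inverse (lead_coeff P):]" by (simp add: is_unit_pCons_iff)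
  hence "prime_elem ([:inverse (lead_coeff P):] * P)"
    using assms by (simp only: prime_elem_mult_unit_left)
  ultimately show ?thesis by (simp add: monic_prime_def)
qed

lemma exists_monic_prime_dvd:
  fixes a :: "'a::field poly"
  assumes "degree a > 0"
  obtains P where "monic_prime P" "P dvd a"
proof -
  obtain P where P: "prime_elem P" "P dvd a" using exists_prime_elem_dvd[OF assms] .
  have "P \<noteq> 0" using P by auto
  show thesis
    by (rule that[OF monic_prime_normalize[OF P(1)]]) (use P \<open>P \<noteq> 0\<close> in \<open>simp add: smult_dvd_iff\<close>)
qed

lemma monic_dvd_same_degree:
  fixes a b :: "'a::field poly"
  assumes "a dvd b" "degree b \<le> degree a" "lead_coeff a = 1" "lead_coeff b = 1"
  shows "a = b"
proof -
  obtain c where c: "b = a * c" using assms(1) by blast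
  have nz: "a \<noteq> 0" "b \<noteq> 0" "c \<noteq> 0" using assms c by auto
  hence "degree c = 0" using assms(2) c by (simp add: degree_mult_eq)
  then obtain k where k: "c = [:k:]" by (auto elim: degree_eq_zeroE)
  thus ?thesis using c assms(3,4) nz by auto
qed

lemma monic_prime_dvd_monic_prime:
  assumes "monic_prime P" "monic_prime Q" "P dvd Q"
  shows "P = Q"
proof -
  obtain c where c: "Q = P * c" using assms(3) by blast
  have "irreducible Q" using assms(2) by (simp add: monic_prime_def prime_elem_imp_irreducible)
  hence "is_unit c" using c irreducibleD monic_primeD(5)[OF assms(1)] by blast
  moreover have "c \<noteq> 0" using c monic_primeD(4)[OF assms(2)] by auto
  ultimately have "degree Q = degree P"
    using c monic_primeD(4)[OF assms(1)] by (simp add: degree_mult_eq is_unit_iff_degree)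
  thus ?thesis using monic_dvd_same_degree[OF assms(3)] monic_primeD(2) assms by (metis order_refl)
qed

lemma prime_elem_bezout:
  fixes P :: "'a::field poly"
  assumes "prime_elem P" "\<not> P dvd a"
  obtains x y where "x * P + y * a = 1"
proof -
  obtain g x y where g: "g dvd P" "g dvd a" "g = x * P + y * a" using poly_bezout[of P a] by metis
  have "is_unit g"
    using g(1,2) assms by (meson dvd_trans irreducibleD' prime_elem_imp_irreducible)
  then obtain h where "1 = g * h" by blast
  hence "(h * x) * P + (h * y) * a = 1" using g(3) by (simp add: algebra_simps)
  thus thesis using that by blast
qed

section \<open>Valuations at a monic prime\<close>

lemma finite_power_dvd:
  fixes P :: "'a::field poly"
  assumes "degree P > 0" "a \<noteq> 0"
  shows "finite {n. P ^ n dvd a}"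
proof (rule finite_subset)
  show "{n. P ^ n dvd a} \<subseteq> {..degree a}"
  proof
    fix n assume "n \<in> {n. P ^ n dvd a}"
    hence "degree (P ^ n) \<le> degree a" using assms by (auto intro: dvd_imp_degree_le)
    hence "degree P * n \<le> degree a" using assms by (subst (asm) degree_power_eq) (auto simp: mult.commute)
    moreover have "n \<le> degree P * n" using assms(1) by (cases "degree P") auto
    ultimately show "n \<in> {..degree a}" unfolding atMost_iff by (rule order_trans[rotated])
  qed
qed simp

text \<open>The library's \<open>multiplicity\<close> and \<open>gcd\<close> require type class instances that
  polynomials over an arbitrary field do not have.\<close>

definition pval :: "'a::field poly \<Rightarrow> 'a poly \<Rightarrow> nat"
  where "pval P a = Max {n. P ^ n dvd a}"

lemma power_dvd_iff_le_pval:
  assumes "monic_prime P" "a \<noteq> 0"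
  shows "P ^ n dvd a \<longleftrightarrow> n \<le> pval P a"
proof
  have fin: "finite {n. P ^ n dvd a}"
    using finite_power_dvd monic_primeD(3) assms by blast
  show "n \<le> pval P a" if "P ^ n dvd a"
    unfolding pval_def using fin that by (intro Max_ge) auto
  have "pval P a \<in> {n. P ^ n dvd a}"
    unfolding pval_def using fin by (rule Max_in) (auto intro: exI[of _ 0])
  thus "P ^ n dvd a" if "n \<le> pval P a"
    using that by (auto intro: power_le_dvd)
qed

lemma pval_eqI:
  assumes "monic_prime P" "\<not> P dvd b"
  shows "pval P (P ^ n * b) = n"
proof -
  have nz: "P ^ n * b \<noteq> 0" using monic_primeD(4)[OF assms(1)] assms(2) by auto
  have "\<not> P ^ Suc n dvd P ^ n * b"
    using assms monic_primeD(4)[OF assms(1)] by (simp add: mult.commute[of P])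
  hence "\<not> Suc n \<le> pval P (P ^ n * b)" "n \<le> pval P (P ^ n * b)"
    by (simp_all add: power_dvd_iff_le_pval[OF assms(1) nz, symmetric] del: power_Suc)
  thus ?thesis by simp
qed

lemma pval_decompose:
  assumes "monic_prime P" "a \<noteq> 0"
  obtains b where "a = P ^ pval P a * b" "\<not> P dvd b"
proof -
  obtain b where b: "a = P ^ pval P a * b"
    using power_dvd_iff_le_pval[OF assms, of "pval P a"] by blast
  have "\<not> P dvd b"
  proof
    assume "P dvd b"
    then obtain c where "b = P * c" by blast
    hence "a = P ^ Suc (pval P a) * c" using b by (simp add: mult_ac)
    hence "P ^ Suc (pval P a) dvd a" by (metis dvd_triv_left)
    thus False using power_dvd_iff_le_pval[OF assms, of "Suc (pval P a)"] by simp
  qed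
  with b show thesis using that by blast
qed

lemma pval_pos_iff:
  assumes "monic_prime P" "a \<noteq> 0"
  shows "pval P a > 0 \<longleftrightarrow> P dvd a"
  using power_dvd_iff_le_pval[OF assms, of 1] by auto

lemma pval_mult:
  assumes "monic_prime P" "a \<noteq> 0" "b \<noteq> 0"
  shows "pval P (a * b) = pval P a + pval P b"
proof -
  obtain x where x: "a = P ^ pval P a * x" "\<not> P dvd x" using pval_decompose assms by blast
  obtain y where y: "b = P ^ pval P b * y" "\<not> P dvd y" using pval_decompose assms by blast
  have eq: "a * b = P ^ (pval P a + pval P b) * (x * y)"
    by (subst x(1), subst y(1)) (simp add: power_add)
  have nd: "\<not> P dvd x * y"
    using x(2) y(2) monic_primeD(1)[OF assms(1)] by (simp add: prime_elem_dvd_mult_iff)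
  show ?thesis unfolding eq using pval_eqI[OF assms(1) nd] .
qed

text \<open>Unique factorization in local form: a prime factor of \<open>a\<close> is cancelled from
  both sides until \<open>a\<close> is constant. Divisibility between Carlitz values is thus checked
  one prime at a time.\<close>

lemma pval_le_imp_dvd:
  fixes a b :: "'a::field poly"
  assumes "a \<noteq> 0" "b \<noteq> 0" "\<And>P. monic_prime P \<Longrightarrow> pval P a \<le> pval P b"
  shows "a dvd b"
  using assms
proof (induction "degree a" arbitrary: a b rule: less_induct)
  case less
  show ?case
  proof (cases "degree a = 0")
    case True
    thus ?thesis using less.prems(1) by (metis is_unit_iff_degree unit_imp_dvd)
  next
    case False
    then obtain P where P: "monic_prime P" "P dvd a" using exists_monic_prime_dvd by blast
    note P' = monic_primeD[OF P(1)]
    have "pval P a \<ge> 1"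
      using power_dvd_iff_le_pval[OF P(1) less.prems(1), of 1] P(2) by simp
    hence "pval P b \<ge> 1" using less.prems(3)[OF P(1)] by linarith
    hence "P dvd b" using power_dvd_iff_le_pval[OF P(1) less.prems(2), of 1] by simp
    then obtain a' b' where ab: "a = P * a'" "b = P * b'" using P(2) by blast
    have nz: "a' \<noteq> 0" "b' \<noteq> 0" using ab less.prems by auto
    have "a' dvd b'"
    proof (rule less.hyps)
      show "degree a' < degree a" using ab nz P' by (simp add: degree_mult_eq)
      fix Q :: "'a poly" assume Q: "monic_prime Q"
      show "pval Q a' \<le> pval Q b'"
        using less.prems(3)[OF Q] pval_mult[OF Q P'(4) nz(1)]
          pval_mult[OF Q P'(4) nz(2)] ab by simp
    qed (use nz in auto)
    thus ?thesis using ab by simp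
  qed
qed

text \<open>Such polynomials correspond to coefficient lists of length \<open>n\<close>. For
  \<open>n = 0\<close> the count would fail, since the zero polynomial has degree
  \<open>0\<close>.\<close>

lemma card_degree_less:
  assumes "n > 0"
  shows "finite {p::'a::{finite,zero} poly. degree p < n}"
    "card {p::'a poly. degree p < n} = CARD('a) ^ n"
proof -
  have eq: "{p::'a poly. degree p < n} = Poly ` {xs. set xs \<subseteq> UNIV \<and> length xs = n}"
  proof (intro equalityI subsetI)
    fix p :: "'a poly" assume p: "p \<in> {p. degree p < n}"
    have "p = Poly (map (coeff p) [0..<n])"
      using p by (intro poly_eqI) (auto simp: nth_default_def coeff_eq_0)
    thus "p \<in> Poly ` {xs. set xs \<subseteq> UNIV \<and> length xs = n}" by (rule image_eqI) auto
  qed (use assms in \<open>auto intro!: degree_lessI simp: nth_default_def\<close>)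
  have inj: "inj_on (Poly :: 'a list \<Rightarrow> _) {xs. set xs \<subseteq> UNIV \<and> length xs = n}"
  proof (rule inj_onI)
    fix xs ys :: "'a list"
    assume *: "xs \<in> {xs. set xs \<subseteq> UNIV \<and> length xs = n}" "ys \<in> {xs. set xs \<subseteq> UNIV \<and> length xs = n}"
      "Poly xs = Poly ys"
    show "xs = ys"
    proof (rule nth_equalityI)
      fix i assume "i < length xs"
      moreover have "nth_default 0 xs i = nth_default 0 ys i" by (metis *(3) coeff_Poly_eq)
      ultimately show "xs ! i = ys ! i" using * by (simp add: nth_default_def)
    qed (use * in auto)
  qed
  show "finite {p::'a poly. degree p < n}"
    unfolding eq by (rule finite_imageI) (rule finite_lists_length_eq, simp)
  show "card {p::'a poly. degree p < n} = CARD('a) ^ n"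
    unfolding eq card_image[OF inj] using card_lists_length_eq[of "UNIV :: 'a set" n] by simp
qed

subsection \<open>Congruences modulo a prime polynomial\<close>

text \<open>Lagrange's bound on roots in the residue domain modulo \<open>p\<close>, phrased with
  pairwise incongruent representatives instead of a quotient ring. The condition on the leading
  coefficient keeps the degree from dropping modulo \<open>p\<close>.\<close>

lemma card_roots_mod_prime_le:
  fixes f :: "'b::idom poly"
  assumes "prime_elem p" "finite S" "\<And>a. a \<in> S \<Longrightarrow> p dvd poly f a"
    and "\<And>a b. a \<in> S \<Longrightarrow> b \<in> S \<Longrightarrow> a \<noteq> b \<Longrightarrow> \<not> p dvd a - b"
    and "\<not> p dvd lead_coeff f"
  shows "card S \<le> degree f"
  using assms(2-)
proof (induction "degree f" arbitrary: f S)
  case 0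
  have "S = {}"
  proof (rule ccontr)
    assume "S \<noteq> {}"
    then obtain a where "a \<in> S" by blast
    moreover obtain c where "f = [:c:]" using 0(1) by (metis degree_eq_zeroE)
    ultimately show False using 0 by auto
  qed
  thus ?case by simp
next
  case (Suc n)
  show ?case
  proof (cases "S = {}")
    case False
    then obtain a where a: "a \<in> S" by blast
    define g where "g = synthetic_div f a"
    have f: "f = [:-a, 1:] * g + [:poly f a:]"
      unfolding g_def by (rule synthetic_div_correct'[symmetric])
    have dg: "degree g = n" using Suc(2) by (simp add: g_def degree_synthetic_div)
    have "lead_coeff f = lead_coeff g"
    proof -
      have "coeff f (Suc n) = coeff ([:-a, 1:] * g + [:poly f a:]) (Suc n)"
        by (rule arg_cong[OF f])
      also have "\<dots> = coeff g n" using dg by (simp add: coeff_eq_0)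
      finally show ?thesis using dg Suc(2) by simp
    qed
    moreover have "p dvd poly g b" if "b \<in> S - {a}" for b
    proof -
      have "poly f b = (b - a) * poly g b + poly f a"
        using arg_cong[OF f, of "\<lambda>h. poly h b"] by (simp add: algebra_simps)
      hence "p dvd (b - a) * poly g b"
        using Suc.prems(2)[of b] Suc.prems(2)[OF a] that by (metis Diff_iff dvd_add_left_iff)
      thus ?thesis using assms(1) Suc.prems(3)[of b a] that a by (auto simp: prime_elem_dvd_mult_iff)
    qed
    ultimately have "card (S - {a}) \<le> degree g"
      using Suc.prems by (intro Suc.hyps(1)) (auto simp: dg)
    thus ?thesis using a Suc.prems(1) Suc(2) dg by simp
  qed simp
qed

lemma eq_if_dvd_diff_degree_less:
  fixes P :: "'a::field poly"
  assumes "degree a < degree P" "degree b < degree P" "P dvd a - b"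
  shows "a = b"
proof (rule ccontr)
  assume "a \<noteq> b"
  hence "degree P \<le> degree (a - b)" using assms(3) by (intro dvd_imp_degree_le) auto
  also have "degree (a - b) < degree P" using assms by (intro degree_diff_less) auto
  finally show False by simp
qed

lemma prime_elem_dvd_prod:
  fixes p :: "'b::comm_semiring_1"
  assumes "prime_elem p" "p dvd (\<Prod>x\<in>A. f x)"
  shows "\<exists>x\<in>A. p dvd f x"
  using assms(2)
  by (induction A rule: infinite_finite_induct)
     (use assms(1) in \<open>auto simp: prime_elem_dvd_mult_iff prime_elem_not_unit\<close>)

text \<open>Multiplication by \<open>a\<close> permutes the nonzero residues \<open>R\<close>;
  comparing the products over \<open>R\<close> gives the congruence.\<close>

lemma poly_fermat_little:
  fixes P a :: "'a::finite_field poly"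
  assumes "monic_prime P"
  shows "P dvd a ^ (CARD('a) ^ degree P) - a"
proof (cases "P dvd a")
  case True
  thus ?thesis by (intro dvd_diff dvd_power_le[where n = 1, simplified] dvd_trans[OF True dvd_power]) auto
next
  case False
  note P = monic_primeD[OF assms]
  let ?q = "CARD('a) ^ degree P"
  define R where "R = {p::'a poly. degree p < degree P} - {0}"
  have fin: "finite R" using card_degree_less(1)[OF P(3)] by (simp add: R_def)
  have card: "card R = ?q - 1"
    using card_degree_less[OF P(3), where ?'a='a] P(3) by (simp add: R_def)
  have nd: "\<not> P dvd r" if "r \<in> R" for r
    using eq_if_dvd_diff_degree_less[of r P 0] that P(3) by (auto simp: R_def)
  have inj: "inj_on (\<lambda>r. (a * r) mod P) R"
  proof (rule inj_onI)
    fix r s assume rs: "r \<in> R" "s \<in> R" "(a * r) mod P = (a * s) mod P"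
    hence "P dvd a * (r - s)" by (simp add: mod_eq_dvd_iff right_diff_distrib)
    hence "P dvd r - s" using False P(1) by (simp add: prime_elem_dvd_mult_iff)
    thus "r = s" using rs by (intro eq_if_dvd_diff_degree_less[of r P s]) (auto simp: R_def)
  qed
  have "(\<lambda>r. (a * r) mod P) ` R \<subseteq> R"
  proof
    fix y assume "y \<in> (\<lambda>r. (a * r) mod P) ` R"
    then obtain r where r: "r \<in> R" "y = (a * r) mod P" by blast
    have "\<not> P dvd a * r" using nd[OF r(1)] False P(1) by (simp add: prime_elem_dvd_mult_iff)
    hence "y \<noteq> 0" using r by (simp add: mod_eq_0_iff_dvd)
    moreover have "degree y < degree P" using degree_mod_less'[of P "a * r"] r P(3,4) calculation by auto
    ultimately show "y \<in> R" by (simp add: R_def)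
  qed
  hence bij: "(\<lambda>r. (a * r) mod P) ` R = R" using endo_inj_surj[OF fin _ inj] by blast
  have "(\<Prod>r\<in>R. r) = (\<Prod>r\<in>R. (a * r) mod P)"
    using prod.reindex[OF inj, of "\<lambda>r. r"] bij by simp
  hence "(\<Prod>r\<in>R. r) mod P = (\<Prod>r\<in>R. a * r) mod P" by (simp add: mod_prod_eq)
  also have "(\<Prod>r\<in>R. a * r) = a ^ (?q - 1) * (\<Prod>r\<in>R. r)"
    by (simp add: prod.distrib card)
  finally have "P dvd (a ^ (?q - 1) - 1) * (\<Prod>r\<in>R. r)"
    by (metis mod_eq_dvd_iff left_diff_distrib mult_1)
  moreover have "\<not> P dvd (\<Prod>r\<in>R. r)"
    using prime_elem_dvd_prod[OF P(1), of "\<lambda>r. r" R] nd by blast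
  ultimately have "P dvd a ^ (?q - 1) - 1" using P(1) by (simp add: prime_elem_dvd_mult_iff)
  hence "P dvd a * (a ^ (?q - 1) - 1)" by (rule dvd_mult)
  also have "a * (a ^ (?q - 1) - 1) = a ^ Suc (?q - 1) - a"
    unfolding power_Suc by (simp only: right_diff_distrib mult_1_right)
  also have "Suc (?q - 1) = ?q" using CARD_power_neq_0[of "degree P", where ?'a='a] by linarith
  finally show ?thesis .
qed

text \<open>The coefficients are fixed by Frobenius, so raising to the power amounts to substituting
  a power of \<open>T\<close> for \<open>T\<close>.\<close>

lemma poly_frobenius:
  fixes a :: "'a::finite_field poly"
  shows "a ^ (CARD('a) ^ i) = pcompose a ([:0, 1:] ^ (CARD('a) ^ i))"
proof (induction a)
  case (pCons c a)
  have eq: "pCons c a = [:c:] + [:0, 1:] * a" by simp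
  show ?case
    unfolding eq frobenius_add power_mult_distrib frobenius_const pCons pcompose_add pcompose_mult
    by (simp add: pcompose_pCons)
qed simp

text \<open>Otherwise every residue modulo \<open>P\<close> would be a root of
  \<open>X ^ ?N - X\<close>, which has only \<open>?N\<close> roots, fewer than there are
  residues.\<close>

lemma not_dvd_T_power_minus_T:
  fixes P :: "'a::finite_field poly"
  assumes "monic_prime P" "0 < i" "i < degree P"
  shows "\<not> P dvd [:0, 1:] ^ (CARD('a) ^ i) - [:0, 1:]"
proof
  let ?N = "CARD('a) ^ i"
  assume *: "P dvd [:0, 1:] ^ ?N - [:0, 1:]"
  note P = monic_primeD[OF assms(1)]
  have q: "CARD('a) > 1" by (rule CARD_gt_1)
  hence N: "?N > 1" using assms(2) one_less_power by blast
  \<comment> \<open>By \<open>poly_frobenius\<close>, \<open>a ^ ?N\<close> is \<open>a\<close>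
    evaluated at \<open>T ^ ?N\<close>, and \<open>X - Y\<close> divides the difference of the
    values of \<open>a\<close> at \<open>X\<close> and \<open>Y\<close>.\<close>
  have dvd: "P dvd a ^ ?N - a" for a :: "'a poly"
  proof -
    have "[:0, 1:] ^ ?N - [:0, 1:] dvd pcompose a ([:0, 1:] ^ ?N) - pcompose a [:0, 1:]" for a :: "'a poly"
    proof (induction a)
      case (pCons c a)
      let ?X = "[:0, 1:] ^ ?N :: 'a poly" and ?Y = "[:0, 1:] :: 'a poly"
      have "pcompose (pCons c a) ?X - pcompose (pCons c a) ?Y =
          ?X * (pcompose a ?X - pcompose a ?Y) + (?X - ?Y) * pcompose a ?Y"
        by (simp add: pcompose_pCons algebra_simps)
      thus ?case using pCons(2) by (metis dvd_add dvd_mult dvd_triv_left)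
    qed simp
    from dvd_trans[OF * this[of a]] show ?thesis
      unfolding poly_frobenius[of a i] by (simp only: pcompose_idR)
  qed
  define f :: "'a poly poly" where "f = monom 1 ?N - monom 1 1"
  have f_coeff: "coeff f ?N = 1" using N by (simp add: f_def)
  have f_deg: "degree f = ?N"
    by (rule antisym, rule degree_le) (use N in \<open>auto simp: f_def intro!: le_degree\<close>)
  let ?S = "{p::'a poly. degree p < degree P}"
  have "card ?S \<le> degree f"
  proof (rule card_roots_mod_prime_le[OF P(1)])
    show "finite ?S" by (rule card_degree_less(1)[OF P(3)])
    show "P dvd poly f a" for a using dvd[of a] by (simp add: f_def poly_monom)
    show "\<not> P dvd lead_coeff f" using P by (simp add: f_deg f_coeff)
    show "\<not> P dvd a - b" if "a \<in> ?S" "b \<in> ?S" "a \<noteq> b" for a b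
      using eq_if_dvd_diff_degree_less that by auto
  qed
  hence "CARD('a) ^ degree P \<le> ?N" by (simp add: card_degree_less(2)[OF P(3)] f_deg)
  thus False using assms(3) power_le_imp_le_exp[OF q] by (meson leD)
qed

subsection \<open>Coefficients and degrees of the Carlitz module\<close>

abbreviation carlitz_act :: "'a::finite_field poly \<Rightarrow> 'a poly \<Rightarrow> 'a poly"
  where "carlitz_act a x \<equiv> twisted_eval (carlitz a) x"

lemma dvd_twisted_eval: "x dvd twisted_eval f (x :: 'a::finite_field poly)"
  unfolding twisted_eval_def
  by (intro dvd_sum dvd_mult dvd_power) (use CARD_power_neq_0 in \<open>auto simp: gr0_conv_Suc[symmetric]\<close>)

lemma carlitz_act_add: "carlitz_act (a + b) x = carlitz_act a x + carlitz_act b x"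
  by (simp add: carlitz_add twisted_eval_add_left)

lemma carlitz_act_mult: "carlitz_act (a * b) x = carlitz_act a (carlitz_act b x)"
  by (simp add: carlitz_mult twisted_eval_mult)

lemma carlitz_act_const: "carlitz_act [:c:] x = smult c x"
  by (simp add: carlitz_const twisted_eval_def)

lemma carlitz_act_1: "carlitz_act 1 x = x"
  using carlitz_act_const[of 1 x] by (simp add: one_pCons)

lemma carlitz_act_diff_1: "carlitz_act (a - 1) x = carlitz_act a x - x"
  using carlitz_act_add[of "a - 1" 1 x] by (simp add: carlitz_act_1)

lemma carlitz_act_pCons:
  "carlitz_act (pCons c a) x = smult c x + carlitz_act [:0, 1:] (carlitz_act a x)"
proof -
  have "pCons c a = [:c:] + [:0, 1:] * a" by simp
  thus ?thesis by (metis carlitz_act_add carlitz_act_mult carlitz_act_const)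
qed

text \<open>If \<open>b = a * h\<close>, the right side is \<open>C_h\<close> applied to the left
  side, and each term of such a value contains the argument.\<close>

lemma carlitz_act_dvd: "a dvd b \<Longrightarrow> carlitz_act a x dvd carlitz_act b x"
  by (metis carlitz_act_mult dvd_twisted_eval dvdE mult.commute)

lemma coeff_C_T_mult:
  fixes f :: "'a::finite_field poly poly"
  shows "coeff ([:[:0, 1:], 1:] \<star> f) i =
    [:0, 1:] * coeff f i + (if i = 0 then 0 else coeff f (i - 1) ^ CARD('a))"
proof -
  have "[:[:0, 1:], 1:] = [:[:0, 1:]:] + monom (1::'a poly) 1" by (simp add: monom_altdef)
  hence "[:[:0, 1:], 1:] \<star> f = smult [:0, 1:] f + monom 1 1 * map_poly (\<lambda>c. c ^ CARD('a)) f"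
    by (simp add: twisted_mult_add_left twisted_mult_const_left twisted_mult_monom_left)
  thus ?thesis
    by (simp add: coeff_monom_mult coeff_map_poly)
qed

lemma coeff_mult_C_T:
  fixes f :: "'a::finite_field poly poly"
  shows "coeff (f \<star> [:[:0, 1:], 1:]) i =
    coeff f i * [:0, 1:] ^ (CARD('a) ^ i) + (if i = 0 then 0 else coeff f (i - 1))"
proof (induction f rule: poly_monom_induct)
  case (1 c j)
  have eq: "[:[:0, 1:], 1:] = monom [:0, 1:] 0 + monom (1::'a poly) 1" by (simp add: monom_altdef)
  show ?case unfolding eq twisted_mult_add_right twisted_mult_monom by auto
qed (simp add: twisted_mult_add_left algebra_simps)

text \<open>Compare coefficients in \<open>C\<^sub>a C\<^sub>T = C\<^sub>T C\<^sub>a\<close>.\<close>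

lemma coeff_carlitz_recursion:
  fixes a :: "'a::finite_field poly"
  shows "([:0, 1:] ^ (CARD('a) ^ Suc i) - [:0, 1:]) * coeff (carlitz a) (Suc i) =
    coeff (carlitz a) i ^ CARD('a) - coeff (carlitz a) i"
proof -
  have "carlitz a \<star> [:[:0, 1:], 1:] = [:[:0, 1:], 1:] \<star> carlitz a"
    by (metis carlitz_T carlitz_mult mult.commute)
  from arg_cong[OF this, of "\<lambda>f. coeff f (Suc i)"]
  have "coeff (carlitz a) (Suc i) * [:0, 1:] ^ (CARD('a) ^ Suc i) + coeff (carlitz a) i =
      [:0, 1:] * coeff (carlitz a) (Suc i) + coeff (carlitz a) i ^ CARD('a)"
    unfolding coeff_C_T_mult coeff_mult_C_T by simp
  moreover have "(X - t) * c = b' - b" if "c * X + b = t * c + b'" for X t c b b' :: "'a poly"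
    using that by (simp add: algebra_simps)
  ultimately show ?thesis by blast
qed

text \<open>One Horner step \<open>C_{c+Ta} = c + C_T C_a\<close>; it drives the inductions for the
  constant term, degree and leading coefficient of \<open>C_a\<close>.\<close>

lemma coeff_carlitz_pCons:
  fixes a :: "'a::finite_field poly"
  shows "coeff (carlitz (pCons c a)) i = (if i = 0 then [:c:] else 0) +
    [:0, 1:] * coeff (carlitz a) i + (if i = 0 then 0 else coeff (carlitz a) (i - 1) ^ CARD('a))"
proof -
  have "pCons c a = [:c:] + [:0, 1:] * a" by simp
  hence "carlitz (pCons c a) = [:[:c:]:] + [:[:0, 1:], 1:] \<star> carlitz a"
    by (metis carlitz_add carlitz_mult carlitz_const carlitz_T)
  hence "coeff (carlitz (pCons c a)) i =
      coeff [:[:c:]:] i + coeff ([:[:0, 1:], 1:] \<star> carlitz a) i"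
    by simp
  moreover have "coeff [:[:c:]:] i = (if i = 0 then [:c:] else 0)"
    by (cases i) auto
  ultimately show ?thesis unfolding coeff_C_T_mult by simp
qed

lemma carlitz_0 [simp]: "carlitz 0 = 0"
  by (simp add: carlitz_def)

lemma coeff_carlitz_0: "coeff (carlitz a) 0 = a"
  by (induction a) (auto simp: coeff_carlitz_pCons)

lemma degree_carlitz_le: "degree (carlitz a) \<le> degree a"
proof -
  have "coeff (carlitz a) i = 0" if "i > degree a" for i
    using that
  proof (induction a arbitrary: i)
    case (pCons c a)
    show ?case
    proof (cases "a = 0")
      case True
      thus ?thesis using pCons by (simp add: coeff_carlitz_pCons power_0_left)
    next
      case False
      thus ?thesis using pCons by (simp add: coeff_carlitz_pCons power_0_left)
    qed
  qed simp
  thus ?thesis by (intro degree_le) auto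
qed

lemma coeff_carlitz_degree: "coeff (carlitz a) (degree a) = [:lead_coeff a:]"
proof (induction a)
  case (pCons c a)
  show ?case
  proof (cases "a = 0")
    case True
    thus ?thesis by (simp add: coeff_carlitz_pCons)
  next
    case False
    moreover have "coeff (carlitz a) (Suc (degree a)) = 0"
      using degree_carlitz_le[of a] by (intro coeff_eq_0) auto
    ultimately show ?thesis
      using pCons frobenius_const[of "lead_coeff a" 1] by (simp add: coeff_carlitz_pCons)
  qed
qed simp

lemma carlitz_act_eq_sum:
  fixes x :: "'a::finite_field poly"
  shows "carlitz_act a x = (\<Sum>i\<le>degree a. coeff (carlitz a) i * x ^ (CARD('a) ^ i))"
  by (rule twisted_eval_le) (rule degree_carlitz_le)

text \<open>Induction along \<open>coeff_carlitz_recursion\<close>: \<open>P\<close> divides its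
  right side but not the factor \<open>T ^ (q ^ Suc i) - T\<close>, as long as
  \<open>Suc i < degree P\<close>.\<close>

lemma prime_dvd_coeff_carlitz:
  fixes P :: "'a::finite_field poly"
  assumes "monic_prime P" "i < degree P"
  shows "P dvd coeff (carlitz P) i"
  using assms(2)
proof (induction i)
  case 0
  show ?case by (simp add: coeff_carlitz_0)
next
  case (Suc i)
  have "P dvd coeff (carlitz P) i ^ CARD('a) - coeff (carlitz P) i"
    using Suc by (intro dvd_diff dvd_trans[OF _ dvd_power]) auto
  hence "P dvd ([:0, 1:] ^ (CARD('a) ^ Suc i) - [:0, 1:]) * coeff (carlitz P) (Suc i)"
    unfolding coeff_carlitz_recursion .
  thus ?case
    using not_dvd_T_power_minus_T[OF assms(1), of "Suc i"] Suc.prems monic_primeD(1)[OF assms(1)]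
    by (simp add: prime_elem_dvd_mult_iff del: power_Suc)
qed

text \<open>Only the monic top term survives, so \<open>C_P\<close> reduces to a power of Frobenius
  modulo \<open>P\<close>.\<close>

lemma prime_dvd_carlitz_act_prime_diff:
  fixes P x :: "'a::finite_field poly"
  assumes "monic_prime P"
  shows "P dvd carlitz_act P x - x ^ (CARD('a) ^ degree P)"
proof -
  have "carlitz_act P x = (\<Sum>i<degree P. coeff (carlitz P) i * x ^ (CARD('a) ^ i)) +
      x ^ (CARD('a) ^ degree P)"
    using monic_primeD(2)[OF assms]
    by (simp add: carlitz_act_eq_sum coeff_carlitz_degree lessThan_Suc_atMost[symmetric] flip: one_pCons)
  moreover have "P dvd (\<Sum>i<degree P. coeff (carlitz P) i * x ^ (CARD('a) ^ i))"
    by (intro dvd_sum dvd_mult2 prime_dvd_coeff_carlitz assms) auto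
  ultimately show ?thesis by simp
qed

text \<open>By Fermat, \<open>C_P(x)\<close> is congruent to \<open>x\<close>; hence
  \<open>P - 1\<close> annihilates the Carlitz module modulo \<open>P\<close>.\<close>

lemma prime_dvd_carlitz_act_prime_minus_1:
  assumes "monic_prime P"
  shows "P dvd carlitz_act (P - 1) x"
  using dvd_add[OF prime_dvd_carlitz_act_prime_diff[OF assms, of x] poly_fermat_little[OF assms, of x]]
  by (simp add: carlitz_act_diff_1)

lemma prime_dvd_carlitz_act_prime_iff:
  assumes "monic_prime P"
  shows "P dvd carlitz_act P x \<longleftrightarrow> P dvd x"
  using prime_dvd_carlitz_act_prime_minus_1[OF assms, of x]
  by (metis carlitz_act_diff_1 dvd_diffD dvd_diff add_diff_cancel_left' diff_add_cancel dvd_add)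

section \<open>Valuations of Carlitz values\<close>

lemma carlitz_act_expansion:
  fixes a y :: "'a::finite_field poly"
  obtains w where "carlitz_act a y = y * (a + y * w)"
proof -
  let ?t = "\<lambda>i. coeff (carlitz a) i * y ^ (CARD('a) ^ i)"
  have "y * y dvd ?t i" if "i \<in> {1..degree a}" for i
  proof -
    have "CARD('a) ^ 1 \<le> CARD('a) ^ i"
      using that CARD_gt_1[where ?'a='a] by (intro power_increasing) auto
    hence "2 \<le> CARD('a) ^ i" using CARD_gt_1[where ?'a='a] unfolding power_one_right by linarith
    hence "y ^ 2 dvd y ^ (CARD('a) ^ i)" by (rule le_imp_power_dvd)
    thus ?thesis by (simp add: power2_eq_square dvd_mult)
  qed
  hence "y * y dvd (\<Sum>i\<in>{1..degree a}. ?t i)" by (rule dvd_sum)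
  then obtain w where w: "(\<Sum>i\<in>{1..degree a}. ?t i) = y * y * w" by blast
  have "{..degree a} = insert 0 {1..degree a}" by auto
  hence "carlitz_act a y = a * y + (\<Sum>i\<in>{1..degree a}. ?t i)"
    by (simp add: carlitz_act_eq_sum coeff_carlitz_0)
  thus thesis using w by (intro that[of w]) (simp add: algebra_simps)
qed

text \<open>Every term beyond the linear one is divisible by \<open>P * y * P\<close>: the middle
  ones gain a factor \<open>P\<close> from their coefficient, and the top one contains
  \<open>y ^ 3\<close> because \<open>q\<close> is at least \<open>3\<close>. For
  \<open>q = 2\<close> and \<open>degree P = 1\<close> the top term would be only
  \<open>y ^ 2\<close>.\<close>

lemma carlitz_act_prime_expansion:
  fixes P y :: "'a::finite_field poly"
  assumes "CARD('a) > 2" "monic_prime P" "P dvd y"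
  obtains w where "carlitz_act P y = P * y * (1 + P * w)"
proof -
  let ?t = "\<lambda>i. coeff (carlitz P) i * y ^ (CARD('a) ^ i)"
  have "P * y * P dvd ?t i" if i: "i \<in> {1..degree P}" for i
  proof -
    have "CARD('a) ^ 1 \<le> CARD('a) ^ i"
      using i assms(1) by (intro power_increasing) auto
    hence 3: "3 \<le> CARD('a) ^ i" using assms(1) unfolding power_one_right by linarith
    show ?thesis
    proof (cases "i = degree P")
      case True
      have "P * y * P dvd y * y * y" by (intro mult_dvd_mono assms(3) dvd_refl)
      also have "y * y * y = y ^ 3" by (simp add: power3_eq_cube)
      also have "y ^ 3 dvd y ^ (CARD('a) ^ i)" using 3 by (rule le_imp_power_dvd)
      finally show ?thesis by (rule dvd_mult)
    next
      case False
      have "P dvd coeff (carlitz P) i" using prime_dvd_coeff_carlitz[OF assms(2), of i] i False by simp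
      moreover have "y * P dvd y ^ (CARD('a) ^ i)"
      proof -
        have "y * P dvd y ^ 2" unfolding power2_eq_square by (intro mult_dvd_mono assms(3) dvd_refl)
        also have "y ^ 2 dvd y ^ (CARD('a) ^ i)" using 3 by (intro le_imp_power_dvd) simp
        finally show ?thesis .
      qed
      ultimately have "P * (y * P) dvd ?t i" by (rule mult_dvd_mono)
      thus ?thesis by (simp only: mult.assoc)
    qed
  qed
  hence "P * y * P dvd (\<Sum>i\<in>{1..degree P}. ?t i)" by (rule dvd_sum)
  then obtain w where w: "(\<Sum>i\<in>{1..degree P}. ?t i) = P * y * P * w" by blast
  have "{..degree P} = insert 0 {1..degree P}" by auto
  hence "carlitz_act P y = P * y + (\<Sum>i\<in>{1..degree P}. ?t i)"
    by (simp add: carlitz_act_eq_sum coeff_carlitz_0)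
  thus thesis using w by (intro that[of w]) (simp add: algebra_simps)
qed

lemma pval_carlitz_act_coprime:
  assumes "monic_prime P" "P dvd y" "y \<noteq> 0" "\<not> P dvd a"
  shows "pval P (carlitz_act a y) = pval P y"
proof -
  obtain w where w: "carlitz_act a y = y * (a + y * w)" by (rule carlitz_act_expansion)
  have nd: "\<not> P dvd a + y * w" using assms(2,4) by (simp add: dvd_add_left_iff)
  hence "a + y * w \<noteq> 0" by auto
  thus ?thesis
    using nd pval_pos_iff[OF assms(1), of "a + y * w"] by (simp add: w pval_mult[OF assms(1,3)])
qed

lemma pval_carlitz_act_prime:
  fixes P y :: "'a::finite_field poly"
  assumes "CARD('a) > 2" "monic_prime P" "P dvd y" "y \<noteq> 0"
  shows "pval P (carlitz_act P y) = Suc (pval P y)"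
proof -
  obtain w where w: "carlitz_act P y = P * y * (1 + P * w)"
    by (rule carlitz_act_prime_expansion[OF assms(1-3)])
  have nd: "\<not> P dvd 1 + P * w"
    using monic_primeD(5)[OF assms(2)] by (simp add: dvd_add_left_iff)
  hence nz: "1 + P * w \<noteq> 0" by auto
  have "pval P P = 1" using pval_eqI[OF assms(2), of 1 1] monic_primeD(5)[OF assms(2)] by simp
  thus ?thesis
    using nd nz pval_pos_iff[OF assms(2) nz] assms(4) monic_primeD(4)[OF assms(2)]
    by (simp add: w pval_mult[OF assms(2)])
qed

section \<open>Degrees of Carlitz values\<close>

lemma degree_carlitz_act_T:
  fixes x :: "'a::finite_field poly"
  assumes "CARD('a) > 2" "degree x > 0"
  shows "degree (carlitz_act [:0, 1:] x) = degree x * CARD('a)"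
proof -
  have x: "x \<noteq> 0" using assms by auto
  \<comment> \<open>From \<open>q \<ge> 3\<close>, the term \<open>x ^ q\<close> outweighs
    \<open>T * x\<close>; for \<open>q = 2\<close> and \<open>degree x = 1\<close> the two degrees
    would tie.\<close>
  have "degree x * 3 \<le> degree x * CARD('a)" using assms(1) by (intro mult_left_mono) auto
  hence "Suc (degree x) < CARD('a) * degree x" using assms(2) by (subst mult.commute) linarith
  hence "degree ([:0, 1:] * x) < degree (x ^ CARD('a))"
    using x assms by (simp add: degree_mult_eq degree_power_eq mult.commute)
  thus ?thesis using x
    by (simp add: twisted_eval_carlitz_T degree_add_eq_right degree_power_eq mult.commute
        del: mult_pCons_left)
qed

lemma degree_carlitz_act:
  fixes u :: "'a::finite_field poly"
  assumes "CARD('a) > 2" "degree u > 0" "a \<noteq> 0"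
  shows "degree (carlitz_act a u) = degree u * CARD('a) ^ degree a"
  using assms(3)
proof (induction a)
  case (pCons c a)
  show ?case
  proof (cases "a = 0")
    case True
    thus ?thesis using pCons by (simp add: carlitz_act_const)
  next
    case False
    hence IH: "degree (carlitz_act a u) = degree u * CARD('a) ^ degree a" using pCons by simp
    have T: "degree (carlitz_act [:0, 1:] (carlitz_act a u)) = degree (carlitz_act a u) * CARD('a)"
      using IH assms by (intro degree_carlitz_act_T) auto
    have "degree u * 1 \<le> degree u * CARD('a) ^ degree a" by (intro mult_left_mono) auto
    moreover have "degree (carlitz_act a u) * 3 \<le> degree (carlitz_act a u) * CARD('a)"
      using assms(1) by (intro mult_left_mono) auto
    ultimately have "degree u < degree (carlitz_act a u) * CARD('a)"
      using IH assms(2) by linarith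
    hence "degree (smult c u) < degree (carlitz_act [:0, 1:] (carlitz_act a u))"
      using degree_smult_le[of c u] unfolding T by linarith
    hence "degree (carlitz_act (pCons c a) u) = degree (carlitz_act a u) * CARD('a)"
      unfolding carlitz_act_pCons[of c a] T[symmetric] by (rule degree_add_eq_right)
    thus ?thesis using False by (simp add: IH)
  qed
qed simp

text \<open>At the constant \<open>1\<close>, the first application of \<open>C_T\<close> gives
  \<open>T + 1\<close>, of degree \<open>1\<close>; only later applications multiply the degree by
  \<open>q\<close>, so the exponent lags by one.\<close>

lemma degree_carlitz_act_1:
  fixes a :: "'a::finite_field poly"
  assumes "CARD('a) > 2" "degree a > 0"
  shows "degree (carlitz_act a 1) = CARD('a) ^ (degree a - 1)"
  using assms(2)
proof (induction a)
  case (pCons c a)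
  have a0: "a \<noteq> 0" using pCons by auto
  show ?case
  proof (cases "degree a = 0")
    case True
    then obtain k where k: "a = [:k:]" by (metis degree_eq_zeroE)
    have "carlitz_act (pCons c a) 1 = [:c + k, k:]"
      using frobenius_const[of k 1]
      by (simp add: k carlitz_act_pCons[of c] carlitz_act_const twisted_eval_carlitz_T)
    thus ?thesis using a0 k by simp
  next
    case False
    hence IH: "degree (carlitz_act a 1) = CARD('a) ^ (degree a - 1)" using pCons by simp
    have T: "degree (carlitz_act [:0, 1:] (carlitz_act a 1)) = degree (carlitz_act a 1) * CARD('a)"
      using IH assms by (intro degree_carlitz_act_T) auto
    hence "degree (smult c 1) < degree (carlitz_act [:0, 1:] (carlitz_act a 1))"
      using IH by simp
    hence "degree (carlitz_act (pCons c a) 1) = degree (carlitz_act a 1) * CARD('a)"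
      unfolding carlitz_act_pCons[of c a] T[symmetric] by (rule degree_add_eq_right)
    thus ?thesis using False a0 by (simp add: IH flip: power_Suc2)
  qed
qed simp

subsection \<open>Least common multiples of values at maximal divisors\<close>

lemma carlitz_act_neq_0:
  fixes u :: "'a::finite_field poly"
  assumes "CARD('a) > 2" "u \<noteq> 0" "a \<noteq> 0" "degree u > 0 \<or> u = 1"
  shows "carlitz_act a u \<noteq> 0"
proof (cases "degree u > 0")
  case True
  thus ?thesis using degree_carlitz_act[OF assms(1) True assms(3)] by force
next
  case False
  hence u: "u = 1" using assms(4) by simp
  show ?thesis
  proof (cases "degree a > 0")
    case True
    show ?thesis
    proof
      assume 0: "carlitz_act a u = 0"
      \<comment> \<open>A zero value would propagate to the multiple \<open>a * [:0, 1:]\<close>,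
        whose value has positive degree.\<close>
      have "degree (carlitz_act (a * [:0, 1:]) u) = CARD('a) ^ degree a"
        using assms(3) by (simp add: u degree_carlitz_act_1[OF assms(1)] degree_mult_eq del: mult_pCons_right)
      moreover have "carlitz_act a u dvd carlitz_act (a * [:0, 1:]) u"
        by (intro carlitz_act_dvd dvd_triv_left)
      hence "carlitz_act (a * [:0, 1:]) u = 0" unfolding 0 dvd_0_left_iff .
      ultimately show False by simp
    qed
  next
    case False
    then obtain k where "a = [:k:]" by (metis degree_eq_zeroE gr0I)
    thus ?thesis using assms(3) by (simp add: carlitz_act_const u)
  qed
qed

text \<open>The annihilator of \<open>u\<close> modulo \<open>d\<close> is an ideal.\<close>

lemma dvd_carlitz_act_bezout:
  assumes "d dvd carlitz_act a u" "d dvd carlitz_act b u"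
  shows "d dvd carlitz_act (x * a + y * b) u"
  using assms carlitz_act_dvd[of a "x * a" u] carlitz_act_dvd[of b "y * b" u]
  by (simp add: carlitz_act_add) (meson dvd_add dvd_trans)

text \<open>Strong divisibility, read at one prime: for coprime \<open>a\<close> and
  \<open>b\<close>, the gcd of the values at \<open>a * t\<close> and \<open>b * t\<close> is the
  value at \<open>t\<close>.\<close>

lemma pval_carlitz_act_gcd:
  assumes "monic_prime Q" "x * a + y * b = 1"
    and "carlitz_act (a * t) u \<noteq> 0" "carlitz_act (b * t) u \<noteq> 0" "carlitz_act t u \<noteq> 0"
  shows "pval Q (carlitz_act t u) = min (pval Q (carlitz_act (a * t) u)) (pval Q (carlitz_act (b * t) u))"
proof (rule antisym)
  have le: "pval Q (carlitz_act t u) \<le> pval Q (carlitz_act (c * t) u)"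
    if "carlitz_act (c * t) u \<noteq> 0" for c
  proof -
    have "Q ^ pval Q (carlitz_act t u) dvd carlitz_act t u"
      using power_dvd_iff_le_pval[OF assms(1,5)] by simp
    also have "carlitz_act t u dvd carlitz_act (c * t) u" by (rule carlitz_act_dvd) simp
    finally show ?thesis using power_dvd_iff_le_pval[OF assms(1) that] by simp
  qed
  show "pval Q (carlitz_act t u) \<le> min (pval Q (carlitz_act (a * t) u)) (pval Q (carlitz_act (b * t) u))"
    using le assms(3,4) by simp
  let ?k = "min (pval Q (carlitz_act (a * t) u)) (pval Q (carlitz_act (b * t) u))"
  have "Q ^ ?k dvd carlitz_act (x * (a * t) + y * (b * t)) u"
    using power_dvd_iff_le_pval[OF assms(1,3), of ?k] power_dvd_iff_le_pval[OF assms(1,4), of ?k]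
    by (intro dvd_carlitz_act_bezout) simp_all
  also have "x * (a * t) + y * (b * t) = (x * a + y * b) * t" by (simp add: algebra_simps)
  finally show "?k \<le> pval Q (carlitz_act t u)"
    using power_dvd_iff_le_pval[OF assms(1,5), of ?k] assms(2) by simp
qed

text \<open>Distributivity of gcd over lcm, at the level of valuations. The inserted
  \<open>0\<close> gives the empty lcm the value \<open>1\<close>.\<close>

lemma Max_insert_min:
  fixes f g :: "'b \<Rightarrow> nat"
  assumes "finite S" "\<And>p. p \<in> S \<Longrightarrow> g p = min (f p) b"
  shows "Max (insert 0 (g ` S)) = min (Max (insert 0 (f ` S))) b"
proof -
  have "insert 0 (g ` S) = (\<lambda>x. min x b) ` insert 0 (f ` S)"
    using assms(2) by (auto simp: image_image)
  thus ?thesis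
    using mono_Max_commute[of "\<lambda>x. min x b" "insert 0 (f ` S)"] assms(1)
    by (simp add: mono_def min.coboundedI1)
qed

text \<open>
  The polynomial \<open>L\<close> is the least common multiple of the values of the Carlitz module at \<open>m / p\<close>
  for \<open>p \<in> S\<close>, where \<open>m = t \<Prod>S\<close>. By strong divisibility it satisfies
  \<open>L\<^bsub>S \<union> {p}\<^esub>(m) = L\<^bsub>S\<^esub>(m) C\<^bsub>m/p\<^esub>(u) / L\<^bsub>S\<^esub>(m/p)\<close>, so its degree is given by inclusion and exclusion.
  The parameter \<open>\<epsilon>\<close> absorbs the irregular degree of \<open>C\<^sub>1(1)\<close>.
\<close>

lemma carlitz_lcm_exists:
  fixes u :: "'a::finite_field poly" and c D \<epsilon> :: int
  assumes nz: "\<And>a. a \<noteq> 0 \<Longrightarrow> carlitz_act a u \<noteq> 0"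
    and deg: "\<And>a. lead_coeff a = 1 \<Longrightarrow>
      c * int (degree (carlitz_act a u)) = D * int CARD('a) ^ degree a - (if a = 1 then \<epsilon> else 0)"
    and "finite S" "\<And>p. p \<in> S \<Longrightarrow> monic_prime p" "lead_coeff t = 1"
  shows "\<exists>L. L \<noteq> 0 \<and>
    (\<forall>Q. monic_prime Q \<longrightarrow>
      pval Q L = Max (insert 0 ((\<lambda>p. pval Q (carlitz_act (\<Prod>(S - {p}) * t) u)) ` S))) \<and>
    c * (int (degree (carlitz_act (\<Prod>S * t) u)) - int (degree L)) =
      D * int CARD('a) ^ degree t * (\<Prod>p\<in>S. int CARD('a) ^ degree p - 1) -
      (if t = 1 then \<epsilon> * (-1) ^ card S else 0)"
  using assms(3-)
proof (induction S arbitrary: t rule: finite_induct)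
  case empty
  have "pval Q 1 = 0" if "monic_prime Q" for Q :: "'a poly"
    using pval_eqI[OF that, of 1 0] monic_primeD(5)[OF that] by simp
  thus ?case using deg[OF empty(2)] by (intro exI[of _ 1]) simp
next
  case (insert r S t)
  have r: "monic_prime r" and S: "\<And>p. p \<in> S \<Longrightarrow> monic_prime p" using insert.prems by auto
  note r' = monic_primeD[OF r]
  have t0: "t \<noteq> 0" using insert.prems(2) by auto
  have S0: "\<Prod>A \<noteq> 0" if "A \<subseteq> S" for A
    using S monic_primeD(4) that finite_subset[OF that insert.hyps(1)] by (auto simp: prod_zero_iff)
  have rt: "lead_coeff (r * t) = 1" using r' insert.prems(2) by (simp add: lead_coeff_mult)
  \<comment> \<open>Here \<open>r\<close> moves into the cofactor, so \<open>L1\<close> is the lcm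
    over \<open>S\<close> for the full \<open>m\<close>, while \<open>L2\<close> below is the one
    for \<open>m / r\<close>.\<close>
  obtain L1 where L1: "L1 \<noteq> 0"
    "\<And>Q. monic_prime Q \<Longrightarrow>
       pval Q L1 = Max (insert 0 ((\<lambda>p. pval Q (carlitz_act (\<Prod>(S - {p}) * (r * t)) u)) ` S))"
    "c * (int (degree (carlitz_act (\<Prod>S * (r * t)) u)) - int (degree L1)) =
      D * int CARD('a) ^ degree (r * t) * (\<Prod>p\<in>S. int CARD('a) ^ degree p - 1) -
      (if r * t = 1 then \<epsilon> * (-1) ^ card S else 0)"
    using insert.IH[OF S rt] by auto
  obtain L2 where L2: "L2 \<noteq> 0"
    "\<And>Q. monic_prime Q \<Longrightarrow>
       pval Q L2 = Max (insert 0 ((\<lambda>p. pval Q (carlitz_act (\<Prod>(S - {p}) * t) u)) ` S))"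
    "c * (int (degree (carlitz_act (\<Prod>S * t) u)) - int (degree L2)) =
      D * int CARD('a) ^ degree t * (\<Prod>p\<in>S. int CARD('a) ^ degree p - 1) -
      (if t = 1 then \<epsilon> * (-1) ^ card S else 0)"
    using insert.IH[OF S insert.prems(2)] by auto
  define B where "B = carlitz_act (\<Prod>S * t) u"
  have B0: "B \<noteq> 0" unfolding B_def using S0[of S] t0 by (intro nz) simp
  \<comment> \<open>\<open>L2\<close> is the gcd of \<open>L1\<close> and the new value
    \<open>B\<close> at \<open>m / r\<close>, by strong divisibility for \<open>r\<close> and each
    \<open>p\<close> in \<open>S\<close>.\<close>
  have min: "pval Q L2 = min (pval Q L1) (pval Q B)" if Q: "monic_prime Q" for Q
    unfolding L1(2)[OF Q] L2(2)[OF Q]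
  proof (rule Max_insert_min[OF insert.hyps(1)])
    fix p assume p: "p \<in> S"
    let ?t = "\<Prod>(S - {p}) * t"
    have "p \<noteq> r" using p insert.hyps(2) by auto
    hence "\<not> r dvd p" using monic_prime_dvd_monic_prime[OF r S[OF p]] by auto
    then obtain x y where xy: "x * r + y * p = 1" using prime_elem_bezout[OF r'(1)] by blast
    have "?t \<noteq> 0" using S0[of "S - {p}"] t0 by auto
    hence "pval Q (carlitz_act ?t u) =
        min (pval Q (carlitz_act (r * ?t) u)) (pval Q (carlitz_act (p * ?t) u))"
      using r'(4) monic_primeD(4)[OF S[OF p]] by (intro pval_carlitz_act_gcd[OF Q xy] nz) auto
    also have "r * ?t = \<Prod>(S - {p}) * (r * t)" by (simp only: mult_ac)
    also have "p * ?t = \<Prod>S * t" using prod.remove[OF insert.hyps(1) p, of "\<lambda>p. p"] by (simp add: mult_ac)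
    finally show "pval Q (carlitz_act ?t u) =
        min (pval Q (carlitz_act (\<Prod>(S - {p}) * (r * t)) u)) (pval Q B)"
      unfolding B_def .
  qed
  have "L2 dvd L1 * B"
    using L1(1) L2(1) B0 by (intro pval_le_imp_dvd) (auto simp: pval_mult min)
  \<comment> \<open>\<open>K\<close> is the lcm of \<open>L1\<close> and \<open>B\<close>.\<close>
  then obtain K where K: "L1 * B = L2 * K" by blast
  have K0: "K \<noteq> 0" using K L1(1) B0 by auto
  have degK: "int (degree L1) + int (degree B) = int (degree L2) + int (degree K)"
    using arg_cong[OF K, of degree] L1(1) L2(1) B0 K0 by (simp add: degree_mult_eq)
  have "pval Q K = Max (insert 0
      ((\<lambda>p. pval Q (carlitz_act (\<Prod>(insert r S - {p}) * t) u)) ` insert r S))"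
    if Q: "monic_prime Q" for Q
  proof -
    have "pval Q L1 + pval Q B = pval Q L2 + pval Q K"
      using arg_cong[OF K, of "pval Q"] L1(1) L2(1) B0 K0 Q by (simp add: pval_mult)
    hence eq: "pval Q K = max (pval Q B) (pval Q L1)" using min[OF Q] by auto
    have "\<Prod>(insert r S - {p}) * t = \<Prod>(S - {p}) * (r * t)" if "p \<in> S" for p
    proof -
      have "insert r S - {p} = insert r (S - {p})" using that insert.hyps(2) by auto
      thus ?thesis using insert.hyps by (simp add: mult_ac)
    qed
    hence "(\<lambda>p. pval Q (carlitz_act (\<Prod>(insert r S - {p}) * t) u)) ` S =
        (\<lambda>p. pval Q (carlitz_act (\<Prod>(S - {p}) * (r * t)) u)) ` S"
      by (intro image_cong refl) (simp only:)
    moreover have "insert r S - {r} = S" using insert.hyps(2) by auto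
    ultimately have "insert 0
        ((\<lambda>p. pval Q (carlitz_act (\<Prod>(insert r S - {p}) * t) u)) ` insert r S) =
        insert (pval Q B) (insert 0 ((\<lambda>p. pval Q (carlitz_act (\<Prod>(S - {p}) * (r * t)) u)) ` S))"
      unfolding image_insert by (simp add: B_def insert_commute)
    thus ?thesis
      unfolding eq L1(2)[OF Q] using insert.hyps(1) by (simp only:) (subst Max_insert; simp)
  qed
  moreover have "c * (int (degree (carlitz_act (\<Prod>(insert r S) * t) u)) - int (degree K)) =
      D * int CARD('a) ^ degree t * (\<Prod>p\<in>insert r S. int CARD('a) ^ degree p - 1) -
      (if t = 1 then \<epsilon> * (-1) ^ card (insert r S) else 0)"
  proof -
    \<comment> \<open>So \<open>\<epsilon>\<close> enters only through \<open>L2\<close>, whose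
      subtraction flips its sign and turns \<open>q ^ degree r\<close> into
      \<open>q ^ degree r - 1\<close>.\<close>
    have "r * t \<noteq> 1" using r'(5) by (metis dvdI)
    hence 1: "c * (int (degree (carlitz_act (\<Prod>S * (r * t)) u)) - int (degree L1)) =
        D * int CARD('a) ^ degree (r * t) * (\<Prod>p\<in>S. int CARD('a) ^ degree p - 1)"
      using L1(3) by simp
    have prod: "\<Prod>(insert r S) * t = \<Prod>S * (r * t)" using insert.hyps by (simp add: mult_ac)
    have degK': "int (degree K) = int (degree L1) + (int (degree B) - int (degree L2))"
      using degK by linarith
    have "c * (int (degree (carlitz_act (\<Prod>(insert r S) * t) u)) - int (degree K)) =
        c * (int (degree (carlitz_act (\<Prod>S * (r * t)) u)) - int (degree L1)) -
        c * (int (degree (carlitz_act (\<Prod>S * t) u)) - int (degree L2))"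
      unfolding prod degK' B_def by (simp only: algebra_simps)
    also have "\<dots> = D * int CARD('a) ^ degree t * (\<Prod>p\<in>insert r S. int CARD('a) ^ degree p - 1) -
        (if t = 1 then \<epsilon> * (-1) ^ card (insert r S) else 0)"
      unfolding 1 L2(3) using insert.hyps t0 r'(4)
      by (simp add: degree_mult_eq power_add algebra_simps)
    finally show ?thesis .
  qed
  ultimately show ?case using K0 by (intro exI[of _ K]) simp
qed

subsection \<open>Intrinsic primes\<close>

text \<open>Without Zsigmondy primes, these are the primes at which the valuation of \<open>C\<^sub>m(u)\<close> exceeds that
  of the least common multiple of the \<open>C\<^bsub>m/p\<^esub>(u)\<close>, namely by one.\<close>

definition intrinsic_prime :: "'a::finite_field poly \<Rightarrow> 'a poly \<Rightarrow> 'a poly \<Rightarrow> bool"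
  where "intrinsic_prime u m P \<longleftrightarrow>
    monic_prime P \<and> P dvd m \<and> P dvd carlitz_act m u \<and>
    (\<forall>p. monic_prime p \<and> p dvd m \<and> p \<noteq> P \<longrightarrow> \<not> P dvd carlitz_act (m div p) u)"

lemma exists_maximal_divisor:
  fixes m :: "'a::field poly"
  assumes "g dvd m" "m \<noteq> 0" "degree g < degree m"
  obtains p where "monic_prime p" "p dvd m" "g dvd m div p"
proof -
  obtain h where h: "m = g * h" using assms(1) by blast
  hence "degree h > 0" using assms(2,3) by (auto simp: degree_mult_eq)
  then obtain p where p: "monic_prime p" "p dvd h" by (rule exists_monic_prime_dvd)
  obtain k where k: "h = p * k" using p(2) by blast
  have "m = p * (g * k)" using h k by (simp add: mult_ac)
  hence "m div p = g * k" using monic_primeD(4)[OF p(1)] by simp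
  thus thesis using that[of p] p h by (simp add: dvd_mult)
qed

text \<open>The gcd of \<open>m\<close> and \<open>n\<close> also annihilates \<open>u\<close>
  modulo \<open>Q\<close> and is a proper divisor of \<open>m\<close>, so it divides some
  \<open>m div p\<close>.\<close>

lemma exists_maximal_divisor_annihilator:
  fixes u m n :: "'a::finite_field poly"
  assumes "Q dvd carlitz_act m u" "Q dvd carlitz_act n u" "m \<noteq> 0" "n \<noteq> 0" "degree n < degree m"
  obtains p where "monic_prime p" "p dvd m" "Q dvd carlitz_act (m div p) u"
proof -
  obtain g x y where g: "g dvd m" "g dvd n" "g = x * m + y * n" using poly_bezout[of m n] by metis
  have "Q dvd carlitz_act g u" unfolding g(3) by (rule dvd_carlitz_act_bezout[OF assms(1,2)])
  moreover have "degree g < degree m"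
    using dvd_imp_degree_le[OF g(2) assms(4)] assms(5) by simp
  then obtain p where "monic_prime p" "p dvd m" "g dvd m div p"
    using exists_maximal_divisor[OF g(1) assms(3)] by blast
  ultimately show thesis using that[of p] carlitz_act_dvd dvd_trans by blast
qed

text \<open>Factors \<open>P\<close> can be stripped from \<open>m\<close>, since
  \<open>C_P(x)\<close> vanishes modulo \<open>P\<close> only if \<open>x\<close> does. The gcd of
  the remaining \<open>n\<close> with \<open>P - 1\<close> still annihilates \<open>u\<close>; were
  its degree smaller, it would divide \<open>n div p\<close> for some \<open>p \<noteq> P\<close>,
  against intrinsicness.\<close>

lemma intrinsic_prime_decompose:
  fixes u m P :: "'a::finite_field poly"
  assumes "intrinsic_prime u m P" "m \<noteq> 0"
  obtains j n where "m = P ^ j * n" "j > 0" "\<not> P dvd n" "n dvd P - 1" "P dvd carlitz_act n u"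
proof -
  have P: "monic_prime P" "P dvd m" "P dvd carlitz_act m u"
    and max: "\<And>p. monic_prime p \<Longrightarrow> p dvd m \<Longrightarrow> p \<noteq> P \<Longrightarrow> \<not> P dvd carlitz_act (m div p) u"
    using assms(1) by (auto simp: intrinsic_prime_def)
  obtain n where n: "m = P ^ pval P m * n" "\<not> P dvd n" using pval_decompose[OF P(1) assms(2)] .
  have n0: "n \<noteq> 0" using n(2) by auto
  have "P dvd carlitz_act (P ^ j * n) u \<longleftrightarrow> P dvd carlitz_act n u" for j
    by (induction j) (simp_all add: mult.assoc carlitz_act_mult[of P] prime_dvd_carlitz_act_prime_iff P(1))
  hence Pn: "P dvd carlitz_act n u" using P(3) n(1) by metis
  obtain g x y where g: "g dvd n" "g dvd P - 1" "g = x * n + y * (P - 1)"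
    using poly_bezout[of n "P - 1"] by metis
  have Pg: "P dvd carlitz_act g u"
    unfolding g(3) by (rule dvd_carlitz_act_bezout[OF Pn prime_dvd_carlitz_act_prime_minus_1[OF P(1)]])
  have "\<not> degree g < degree n"
  proof
    assume "degree g < degree n"
    then obtain p where p: "monic_prime p" "p dvd n" "g dvd n div p"
      using exists_maximal_divisor[OF g(1) n0] by blast
    have "p dvd m" using p(2) n(1) by (metis dvd_mult)
    moreover have "p \<noteq> P" using p(2) n(2) by auto
    moreover have "m div p = P ^ pval P m * (n div p)"
      using p(2) n(1) by (metis div_mult_swap)
    hence "carlitz_act g u dvd carlitz_act (m div p) u"
      using p(3) by (intro carlitz_act_dvd) (simp add: dvd_mult)
    ultimately show False using max[OF p(1)] Pg dvd_trans by blast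
  qed
  hence "n dvd g"
  proof -
    obtain h where h: "n = g * h" using g(1) by blast
    assume "\<not> degree g < degree n"
    hence "degree h = 0" "h \<noteq> 0" using h n0 by (auto simp: degree_mult_eq)
    hence "is_unit h" by (simp add: is_unit_iff_degree)
    thus ?thesis using h by (simp add: mult_unit_dvd_iff)
  qed
  hence "n dvd P - 1" using g(2) by (rule dvd_trans)
  moreover have "pval P m > 0" using pval_pos_iff[OF P(1) assms(2)] P(2) by simp
  ultimately show thesis using that n Pn by blast
qed

lemma lead_coeff_minus_1:
  fixes P :: "'a::comm_ring_1 poly"
  assumes "degree P > 0"
  shows "degree (P - 1) = degree P" "lead_coeff (P - 1) = lead_coeff P"
proof -
  show *: "degree (P - 1) = degree P"
    using degree_add_eq_left[of "- 1" P] assms by simp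
  show "lead_coeff (P - 1) = lead_coeff P" unfolding * using assms by (simp add: coeff_eq_0)
qed

lemma monic_prime_dvd_power_imp_eq:
  assumes "monic_prime P" "monic_prime Q" "P dvd Q ^ n"
  shows "P = Q"
  using assms monic_prime_dvd_monic_prime prime_elem_dvd_power monic_primeD(1) by blast

text \<open>Each prime divides the part of \<open>m\<close> prime to the other, hence
  \<open>Q dvd P - 1\<close> and \<open>P dvd Q - 1\<close>. The degrees then agree, and monic
  polynomials of equal degree dividing each other coincide.\<close>

lemma two_intrinsic_primes:
  fixes u m P Q :: "'a::finite_field poly"
  assumes "intrinsic_prime u m P" "intrinsic_prime u m Q" "P \<noteq> Q" "lead_coeff m = 1"
  shows "Q = P - 1" "m = (P - 1) * P"
proof -
  have m0: "m \<noteq> 0" using assms(4) by auto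
  have PQ: "monic_prime P" "monic_prime Q" "P dvd m" "Q dvd m"
    using assms(1,2) by (auto simp: intrinsic_prime_def)
  note P = monic_primeD[OF PQ(1)] and Q = monic_primeD[OF PQ(2)]
  obtain i a where a: "m = P ^ i * a" "i > 0" "a dvd P - 1"
    using intrinsic_prime_decompose[OF assms(1) m0] .
  obtain j b where b: "m = Q ^ j * b" "j > 0" "b dvd Q - 1"
    using intrinsic_prime_decompose[OF assms(2) m0] .
  have "\<not> Q dvd P ^ i" "\<not> P dvd Q ^ j" using monic_prime_dvd_power_imp_eq PQ assms(3) by blast+
  hence Qa: "Q dvd a" and Pb: "P dvd b"
    using PQ(3,4) P(1) Q(1) a(1) b(1) by (metis prime_elem_dvd_mult_iff)+
  have nz: "P - 1 \<noteq> 0" "Q - 1 \<noteq> 0" using P(3) Q(3) by auto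
  have "degree Q \<le> degree (P - 1)" "degree P \<le> degree (Q - 1)"
    using dvd_imp_degree_le[OF dvd_trans[OF Qa a(3)]] dvd_imp_degree_le[OF dvd_trans[OF Pb b(3)]] nz
    by auto
  hence deg: "degree P = degree Q" using lead_coeff_minus_1(1) P(3) Q(3) by (metis antisym)
  show QP: "Q = P - 1"
    by (rule monic_dvd_same_degree[OF dvd_trans[OF Qa a(3)]])
       (use lead_coeff_minus_1[OF P(3)] P(2) Q(2) deg in auto)
  \<comment> \<open>Otherwise \<open>P * P\<close> divides \<open>Q ^ j * b\<close>, while
    \<open>b\<close> divides \<open>Q - 1 = P\<close>; this leaves
    \<open>P dvd Q ^ j\<close>.\<close>
  have "i = 1"
  proof (rule ccontr)
    assume "i \<noteq> 1"
    hence "P ^ 2 dvd P ^ i" using a(2) by (intro le_imp_power_dvd) auto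
    hence "P ^ 2 dvd Q ^ j * b" using a(1) b(1) by (metis dvd_mult2)
    moreover have "Q ^ j * b dvd Q ^ j * P"
    proof -
      have "P = Q - 1"
        by (rule monic_dvd_same_degree[OF dvd_trans[OF Pb b(3)]])
           (use lead_coeff_minus_1[OF Q(3)] P(2) Q(2) deg in auto)
      thus ?thesis using b(3) by (intro mult_dvd_mono) auto
    qed
    ultimately have "P * P dvd Q ^ j * P" by (metis dvd_trans power2_eq_square)
    hence "P dvd Q ^ j" using P(4) by simp
    thus False using \<open>\<not> P dvd Q ^ j\<close> by simp
  qed
  \<comment> \<open>\<open>a\<close> is monic, a multiple of \<open>Q\<close> and a divisor of
    \<open>P - 1 = Q\<close>.\<close>
  moreover have "Q = a"
  proof (rule monic_dvd_same_degree[OF Qa])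
    show "degree a \<le> degree Q" using dvd_imp_degree_le[OF a(3) nz(1)] QP by simp
    show "lead_coeff a = 1" using a(1) assms(4) P(2) by (simp add: lead_coeff_mult lead_coeff_power)
  qed (rule Q(2))
  ultimately show "m = (P - 1) * P" using a(1) QP by (simp add: mult.commute)
qed

lemma prod_monic_primes_dvd:
  assumes "finite S" "\<And>p. p \<in> S \<Longrightarrow> monic_prime p" "\<And>p. p \<in> S \<Longrightarrow> p dvd m"
  shows "\<Prod>S dvd m"
  using assms
proof (induction S rule: finite_induct)
  case (insert r S)
  obtain k where k: "m = \<Prod>S * k" using insert by blast
  have r: "monic_prime r" using insert by simp
  have "\<not> r dvd \<Prod>S"
  proof
    assume "r dvd \<Prod>S"
    then obtain p where "p \<in> S" "r dvd p" using prime_elem_dvd_prod[OF monic_primeD(1)[OF r]] by metis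
    thus False using monic_prime_dvd_monic_prime[OF r, of p] insert by auto
  qed
  hence "r dvd k" using insert.prems(2)[of r] k monic_primeD(1)[OF r] by (simp add: prime_elem_dvd_mult_iff)
  thus ?case using insert.hyps k by (simp add: mult.commute[of r] mult_dvd_mono)
qed simp

lemma finite_monic_prime_divisors:
  fixes m :: "'a::finite_field poly"
  assumes "m \<noteq> 0"
  shows "finite {p. monic_prime p \<and> p dvd m}"
  by (rule finite_subset[OF _ card_degree_less(1)[of "Suc (degree m)"]])
     (use assms in \<open>auto intro: dvd_imp_degree_le simp: less_Suc_eq_le\<close>)

text \<open>At an intrinsic \<open>Q\<close>, only \<open>p = Q\<close> can satisfy
  \<open>Q dvd carlitz_act (m div p) u\<close>, and passing from there to \<open>m\<close> adds one
  to the valuation. At any other \<open>Q\<close> dividing the value, some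
  \<open>r \<noteq> Q\<close> leaves the valuation unchanged.\<close>

lemma carlitz_act_dvd_lcm_times_intrinsic:
  fixes u m L :: "'a::finite_field poly"
  assumes q: "CARD('a) > 2" and nz: "\<And>a. a \<noteq> 0 \<Longrightarrow> carlitz_act a u \<noteq> 0" and "m \<noteq> 0" "L \<noteq> 0"
    and L: "\<And>Q p. monic_prime Q \<Longrightarrow> monic_prime p \<Longrightarrow> p dvd m \<Longrightarrow>
      pval Q (carlitz_act (m div p) u) \<le> pval Q L"
    and no_zsigmondy: "\<And>Q. monic_prime Q \<Longrightarrow> Q dvd carlitz_act m u \<Longrightarrow>
      \<exists>p. monic_prime p \<and> p dvd m \<and> Q dvd carlitz_act (m div p) u"
  shows "carlitz_act m u dvd L * \<Prod>{P. intrinsic_prime u m P}"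
proof -
  let ?I = "{P. intrinsic_prime u m P}"
  have fin: "finite ?I"
    by (rule finite_subset[OF _ finite_monic_prime_divisors[OF assms(3)]]) (auto simp: intrinsic_prime_def)
  have I0: "\<Prod>?I \<noteq> 0"
    using fin monic_primeD(4) by (auto simp: intrinsic_prime_def)
  show ?thesis
  proof (rule pval_le_imp_dvd)
    show "carlitz_act m u \<noteq> 0" using nz assms(3) by blast
    show "L * \<Prod>?I \<noteq> 0" using assms(4) I0 by simp
  next
    fix Q :: "'a poly" assume Q: "monic_prime Q"
    have div0: "m div p \<noteq> 0" if "p dvd m" for p using that assms(3) by (metis dvd_div_eq_0_iff)
    have act: "carlitz_act m u = carlitz_act p (carlitz_act (m div p) u)" if "p dvd m" for p
      using that by (metis carlitz_act_mult dvd_mult_div_cancel)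
    show "pval Q (carlitz_act m u) \<le> pval Q (L * \<Prod>?I)"
    proof (cases "Q dvd carlitz_act m u")
      case False
      thus ?thesis using pval_pos_iff[OF Q nz[OF assms(3)]] by simp
    next
      case True
      then obtain p where p: "monic_prime p" "p dvd m" "Q dvd carlitz_act (m div p) u"
        using no_zsigmondy[OF Q] by blast
      show ?thesis
      proof (cases "intrinsic_prime u m Q")
        case True
        hence "p = Q" using p by (auto simp: intrinsic_prime_def)
        hence "pval Q (carlitz_act m u) = Suc (pval Q (carlitz_act (m div Q) u))"
          using pval_carlitz_act_prime[OF q Q p(3) nz[OF div0[OF p(2)]]] act[OF p(2)] by simp
        also have "\<dots> \<le> Suc (pval Q L)" using L[OF Q p(1,2)] \<open>p = Q\<close> by simp
        also have "pval Q (\<Prod>?I) > 0"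
          using pval_pos_iff[OF Q I0] dvd_prodI[OF fin, of Q "\<lambda>p. p"] True by simp
        hence "Suc (pval Q L) \<le> pval Q (L * \<Prod>?I)" by (simp add: pval_mult[OF Q assms(4) I0])
        finally show ?thesis .
      next
        case False
        \<comment> \<open>If \<open>p\<close> happens to be \<open>Q\<close>, the failure of
          intrinsicness supplies another prime.\<close>
        obtain r where r: "monic_prime r" "r dvd m" "Q dvd carlitz_act (m div r) u" "r \<noteq> Q"
        proof (cases "p = Q")
          case True
          thus thesis using False Q p \<open>Q dvd carlitz_act m u\<close> that by (auto simp: intrinsic_prime_def)
        qed (use p that in auto)
        have "\<not> Q dvd r" using monic_prime_dvd_monic_prime[OF Q r(1)] r(4) by auto
        hence "pval Q (carlitz_act m u) = pval Q (carlitz_act (m div r) u)"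
          using pval_carlitz_act_coprime[OF Q r(3) nz[OF div0[OF r(2)]]] act[OF r(2)] by simp
        also have "\<dots> \<le> pval Q L" by (rule L[OF Q r(1,2)])
        also have "\<dots> \<le> pval Q (L * \<Prod>?I)" by (simp add: pval_mult[OF Q assms(4) I0])
        finally show ?thesis .
      qed
    qed
  qed
qed

subsection \<open>Existence of Zsigmondy primes\<close>

lemma zsigmondy_prime_iff:
  "zsigmondy_prime u m P \<longleftrightarrow> monic_prime P \<and> P dvd carlitz_act m u \<and>
    (\<forall>n. n \<noteq> 0 \<and> degree n < degree m \<longrightarrow> \<not> P dvd carlitz_act n u)"
  by (simp add: zsigmondy_prime_def monic_prime_def cong_0_iff)

lemma monic_degree_0_eq_1:
  assumes "lead_coeff a = 1" "degree a = 0"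
  shows "a = 1"
proof -
  obtain k where "a = [:k:]" using assms(2) by (rule degree_eq_zeroE)
  thus ?thesis using assms(1) by (simp add: one_pCons)
qed

text \<open>Compares the exact degree of \<open>C_m(u) / L\<close> with its bound by the product of
  the intrinsic primes. The product on the left is the totient of the radical of
  \<open>m\<close>.\<close>

lemma no_zsigmondy_degree_bound:
  fixes u m :: "'a::finite_field poly" and c D \<epsilon> :: int
  assumes q: "CARD('a) > 2" and nz: "\<And>a. a \<noteq> 0 \<Longrightarrow> carlitz_act a u \<noteq> 0"
    and deg: "\<And>a. lead_coeff a = 1 \<Longrightarrow>
      c * int (degree (carlitz_act a u)) = D * int CARD('a) ^ degree a - (if a = 1 then \<epsilon> else 0)"
    and "c \<ge> 0" "D \<ge> 0" "\<epsilon> \<ge> 0" "lead_coeff m = 1" "\<nexists>P. zsigmondy_prime u m P"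
  shows "D * (\<Prod>p | monic_prime p \<and> p dvd m. int CARD('a) ^ degree p - 1) - \<epsilon> \<le>
    c * (\<Sum>P | intrinsic_prime u m P. int (degree P))"
proof -
  define S where "S = {p. monic_prime p \<and> p dvd m}"
  let ?I = "{P. intrinsic_prime u m P}"
  let ?\<Phi> = "\<Prod>p\<in>S. int CARD('a) ^ degree p - 1"
  have m0: "m \<noteq> 0" using assms(7) by auto
  have fin: "finite S" unfolding S_def by (rule finite_monic_prime_divisors[OF m0])
  have finI: "finite ?I" by (rule finite_subset[OF _ fin]) (auto simp: S_def intrinsic_prime_def)
  have S: "\<And>p. p \<in> S \<Longrightarrow> monic_prime p" by (simp add: S_def)
  have "\<Prod>S dvd m" by (rule prod_monic_primes_dvd[OF fin]) (auto simp: S_def)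
  then obtain t where t: "m = \<Prod>S * t" by blast
  have "lead_coeff (\<Prod>S) = 1"
    using S monic_primeD(2) by (auto simp: lead_coeff_prod intro: prod.neutral)
  hence lt: "lead_coeff t = 1" using assms(7) t by (simp add: lead_coeff_mult)
  obtain L where L: "L \<noteq> 0"
    "\<And>Q. monic_prime Q \<Longrightarrow>
       pval Q L = Max (insert 0 ((\<lambda>p. pval Q (carlitz_act (\<Prod>(S - {p}) * t) u)) ` S))"
    "c * (int (degree (carlitz_act m u)) - int (degree L)) =
      D * int CARD('a) ^ degree t * ?\<Phi> - (if t = 1 then \<epsilon> * (-1) ^ card S else 0)"
    using carlitz_lcm_exists[OF nz deg fin S lt] unfolding t[symmetric] by auto
  have "carlitz_act m u dvd L * \<Prod>?I"
  proof (rule carlitz_act_dvd_lcm_times_intrinsic[OF q nz m0 L(1)])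
    fix Q p :: "'a poly" assume Q: "monic_prime Q" and p: "monic_prime p" "p dvd m"
    have "p \<in> S" using p by (simp add: S_def)
    hence "m = p * (\<Prod>(S - {p}) * t)"
      using prod.remove[OF fin, of p "\<lambda>p. p"] by (subst t) (simp add: mult.assoc)
    hence "m div p = \<Prod>(S - {p}) * t"
      using monic_primeD(4)[OF p(1)] nonzero_mult_div_cancel_left by metis
    thus "pval Q (carlitz_act (m div p) u) \<le> pval Q L"
      unfolding L(2)[OF Q] using fin p by (intro Max_ge) (auto simp: S_def)
  next
    fix Q :: "'a poly" assume Q: "monic_prime Q" "Q dvd carlitz_act m u"
    then obtain n where "n \<noteq> 0" "degree n < degree m" "Q dvd carlitz_act n u"
      using assms(8) by (auto simp: zsigmondy_prime_iff)
    thus "\<exists>p. monic_prime p \<and> p dvd m \<and> Q dvd carlitz_act (m div p) u"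
      using exists_maximal_divisor_annihilator[OF Q(2) _ m0] by metis
  qed
  moreover have I0: "\<Prod>?I \<noteq> 0" using finI monic_primeD(4) by (auto simp: intrinsic_prime_def)
  ultimately have "degree (carlitz_act m u) \<le> degree L + degree (\<Prod>?I)"
    using L(1) dvd_imp_degree_le[of "carlitz_act m u" "L * \<Prod>?I"] by (simp add: degree_mult_eq)
  also have "degree (\<Prod>?I) = (\<Sum>P\<in>?I. degree P)"
    using monic_primeD(4) by (intro degree_prod_eq_sum_degree) (auto simp: intrinsic_prime_def)
  finally have "int (degree (carlitz_act m u)) - int (degree L) \<le> (\<Sum>P\<in>?I. int (degree P))"
    unfolding of_nat_sum[symmetric] by linarith
  hence "c * (int (degree (carlitz_act m u)) - int (degree L)) \<le> c * (\<Sum>P\<in>?I. int (degree P))"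
    using assms(4) by (rule mult_left_mono)
  \<comment> \<open>The non-squarefree part \<open>t\<close> only enlarges the left side.\<close>
  moreover have "D * ?\<Phi> \<le> D * int CARD('a) ^ degree t * ?\<Phi>"
  proof -
    have "?\<Phi> \<ge> 0" using q by (intro prod_nonneg) auto
    moreover have "1 \<le> int CARD('a) ^ degree t" using q by (intro one_le_power) auto
    hence "D * 1 \<le> D * int CARD('a) ^ degree t" using assms(5) by (intro mult_left_mono)
    ultimately show ?thesis by (intro mult_right_mono) auto
  qed
  moreover have "(if t = 1 then \<epsilon> * (-1) ^ card S else 0) \<le> \<epsilon>"
    using assms(6) by (cases "even (card S)") auto
  ultimately show ?thesis using L(3) unfolding S_def by linarith
qed

section \<open>Numerical estimates and the exceptional case\<close>

lemma bernoulli_int: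
  assumes "(Q::int) \<ge> 1"
  shows "int d * (Q - 1) \<le> Q ^ d - 1"
proof (induction d)
  case (Suc d)
  have "Q ^ d \<ge> 1" using assms by simp
  hence "1 * (Q - 1) \<le> Q ^ d * (Q - 1)" using assms by (intro mult_right_mono) auto
  thus ?case using Suc by (simp add: algebra_simps)
qed simp

text \<open>For two intrinsic primes of degree \<open>d\<close>: the totient is at least
  \<open>(Q ^ d - 1) ^ 2\<close> and the degrees sum to \<open>2 * d\<close>.\<close>

lemma totient_bound:
  assumes "(Q::int) \<ge> 4" "d \<ge> 1" "Q * (2 * int d) \<ge> (Q ^ d - 1) ^ 2 - 1"
  shows "Q = 4" "d = 1"
proof -
  have X: "int d * (Q - 1) \<le> Q ^ d - 1" using assms(1) by (intro bernoulli_int) auto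
  show d: "d = 1"
  proof (rule ccontr)
    assume "d \<noteq> 1"
    hence d: "d \<ge> 2" using assms(2) by simp
    \<comment> \<open>With \<open>d \<ge> 2\<close> the square is at least
      \<open>6 * d * (Q - 1)\<close>, which exceeds \<open>2 * d * Q\<close> by too much.\<close>
    have "2 * 3 \<le> int d * (Q - 1)" using d assms(1) by (intro mult_mono) auto
    hence "(Q ^ d - 1) ^ 2 \<ge> (int d * (Q - 1)) * (int d * (Q - 1))"
      using X unfolding power2_eq_square by (intro mult_mono) auto
    moreover have "(int d * (Q - 1)) * (int d * (Q - 1)) \<ge> (int d * (Q - 1)) * 6"
      using \<open>2 * 3 \<le> int d * (Q - 1)\<close> by (intro mult_left_mono) auto
    ultimately have "6 * (int d * (Q - 1)) - 1 \<le> Q * (2 * int d)" using assms(3) by linarith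
    hence "4 * (int d * Q) \<le> 6 * int d + 1" by (simp add: algebra_simps)
    moreover have "int d * 4 \<le> int d * Q" using assms(1) by (intro mult_left_mono) auto
    ultimately show False using d by linarith
  qed
  have "(Q - 1) ^ 2 - 1 \<le> Q * 2" using assms(3) d by simp
  hence "Q * Q \<le> Q * 4" by (simp add: power2_eq_square algebra_simps)
  thus "Q = 4" using assms(1) by simp
qed

text \<open>In characteristic two, \<open>C_{P-1}(1) = P\<close> and \<open>C_P(1) = P + 1\<close>,
  while the value at \<open>(P - 1) * P\<close> is \<open>C_P(P) = P^2 (P + 1)^2\<close>. So each of
  its primes already divides a value at a polynomial of degree \<open>1\<close>.\<close>

lemma exceptional_case_no_zsigmondy:
  fixes P :: "'a::finite_field poly"
  assumes "CARD('a) = 4" "lead_coeff P = 1" "degree P = 1"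
  shows "\<nexists>Q. zsigmondy_prime 1 ((P - 1) * P) Q"
proof
  assume "\<exists>Q. zsigmondy_prime 1 ((P - 1) * P) Q"
  then obtain Q where Q: "monic_prime Q" "Q dvd carlitz_act ((P - 1) * P) 1"
    and min: "\<And>n. n \<noteq> 0 \<Longrightarrow> degree n < degree ((P - 1) * P) \<Longrightarrow> \<not> Q dvd carlitz_act n 1"
    by (auto simp: zsigmondy_prime_iff)
  have two: "(2::'a poly) = 0"
  proof -
    \<comment> \<open>\<open>4 choose 1\<close> vanishes in the field, which forces characteristic
      two.\<close>
    have "(of_nat (CARD('a) choose 1) :: 'a) = 0" by (rule of_nat_CARD_choose) (use assms in auto)
    hence "(2::'a) * 2 = 0" using assms(1) by simp
    hence "(2::'a) = 0" unfolding mult_eq_0_iff by blast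
    hence "[:2::'a:] = 0" by simp
    thus ?thesis by (simp add: numeral_poly)
  qed
  have degs: "degree (P - 1) = 1" "P - 1 \<noteq> 0" "P \<noteq> 0" using lead_coeff_minus_1(1)[of P] assms(3) by auto
  hence "degree ((P - 1) * P) = 2" using assms(3) by (simp add: degree_mult_eq)
  hence nd: "\<not> Q dvd carlitz_act P 1" "\<not> Q dvd carlitz_act (P - 1) 1"
    using min degs assms(3) by auto
  obtain k where k: "P = [:k, 1:]"
  proof -
    have "P = [:coeff P 0, coeff P 1:]"
      using assms(3) by (intro poly_eqI) (auto simp: coeff_pCons coeff_eq_0 split: nat.split)
    thus thesis using that assms(2,3) by simp
  qed
  have act: "carlitz_act P x = P * x + x ^ 4" for x
  proof -
    have "P = [:k:] + [:0, 1:]" by (simp add: k)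
    hence "carlitz_act P x = smult k x + ([:0, 1:] * x + x ^ 4)"
      using carlitz_act_add[of "[:k:]" "[:0, 1:]" x] twisted_eval_carlitz_T[of x] assms(1)
      by (simp add: carlitz_act_const)
    thus ?thesis by (simp add: k)
  qed
  have P1: "carlitz_act (P - 1) 1 = P" by (simp add: carlitz_act_diff_1 act)
  have "carlitz_act ((P - 1) * P) 1 = carlitz_act P P"
    by (simp add: mult.commute[of "P - 1"] carlitz_act_mult P1)
  also have "\<dots> = P * P * ((P + 1) * (P + 1)) - 2 * (P * P * P)"
    by (simp add: act power4_eq_xxxx algebra_simps)
  also have "\<dots> = P * P * ((P + 1) * (P + 1))" by (simp add: two)
  finally have "Q dvd P \<or> Q dvd P + 1" using Q(2) by (simp add: prime_elem_dvd_mult_iff monic_primeD(1)[OF Q(1)])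
  thus False using nd by (simp add: P1 act)
qed

theorem theorem5p2:
  fixes m u :: "'a::finite_field poly" and e :: nat
  assumes "CARD('a) = 2 ^ e" and "CARD('a) > 2"
    and "lead_coeff m = 1" and "lead_coeff u = 1"
    and "degree m > 0 \<or> degree u > 0"
  shows "(\<exists>P. zsigmondy_prime u m P) \<longleftrightarrow>
    \<not> (CARD('a) = 4 \<and> u = 1 \<and>
       (\<exists>P. prime_elem P \<and> lead_coeff P = 1 \<and> degree P = 1 \<and> m = (P - 1) * P))"
proof
  assume "\<exists>P. zsigmondy_prime u m P"
  thus "\<not> (CARD('a) = 4 \<and> u = 1 \<and>
       (\<exists>P. prime_elem P \<and> lead_coeff P = 1 \<and> degree P = 1 \<and> m = (P - 1) * P))"
    using exceptional_case_no_zsigmondy by blast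
next
  assume not_exceptional: "\<not> (CARD('a) = 4 \<and> u = 1 \<and>
       (\<exists>P. prime_elem P \<and> lead_coeff P = 1 \<and> degree P = 1 \<and> m = (P - 1) * P))"
  define q where "q = int CARD('a)"
  have q4: "q \<ge> 4"
  proof -
    have "e \<ge> 2" using assms(1,2) by (cases e rule: nat.exhaust; cases "e - 1") auto
    hence "(2::nat) ^ 2 \<le> 2 ^ e" by (intro power_increasing) auto
    hence "4 \<le> CARD('a)" using assms(1) by simp
    thus ?thesis by (simp add: q_def)
  qed
  show "\<exists>P. zsigmondy_prime u m P"
  proof (cases "degree m = 0")
    case True
    \<comment> \<open>No nonzero \<open>n\<close> has degree below \<open>0\<close>, so any prime
      factor of \<open>u = C_1(u)\<close> works.\<close>
    hence "m = 1" by (rule monic_degree_0_eq_1[OF assms(3)])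
    moreover have "degree u > 0" using assms(5) True by simp
    then obtain P where "monic_prime P" "P dvd u" by (rule exists_monic_prime_dvd)
    ultimately have "zsigmondy_prime u m P" by (simp add: zsigmondy_prime_iff carlitz_act_1)
    thus ?thesis ..
  next
    case m: False
    show ?thesis
    proof (rule ccontr)
      assume none: "\<nexists>P. zsigmondy_prime u m P"
      define S where "S = {p. monic_prime p \<and> p dvd m}"
      define I where "I = {P. intrinsic_prime u m P}"
      define \<Phi> where "\<Phi> = (\<Prod>p\<in>S. q ^ degree p - 1)"
      \<comment> \<open>For \<open>u = 1\<close> the degree at \<open>a\<close> is
        \<open>q ^ degree a / q\<close>, so \<open>c = q\<close> clears the denominator. At
        \<open>a = 1\<close> the degree is \<open>0\<close> instead of \<open>1 / q\<close>, which
        \<open>\<epsilon> = 1\<close> corrects.\<close>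
      define c D \<epsilon> where "c = (if degree u > 0 then 1 else q)"
        and "D = (if degree u > 0 then int (degree u) else 1)"
        and "\<epsilon> = (if degree u > 0 then 0 else 1 :: int)"
      have m0: "m \<noteq> 0" "u \<noteq> 0" using assms(3,4) by auto
      have u1: "u = 1" if "degree u = 0"
        using assms(4) that by (rule monic_degree_0_eq_1)
      have "D * \<Phi> - \<epsilon> \<le> c * (\<Sum>P\<in>I. int (degree P))"
        unfolding \<Phi>_def S_def I_def q_def
      proof (rule no_zsigmondy_degree_bound[OF assms(2) _ _ _ _ _ assms(3) none])
        show "carlitz_act a u \<noteq> 0" if "a \<noteq> 0" for a
          using carlitz_act_neq_0[OF assms(2) m0(2) that] u1 by blast
        fix a :: "'a poly" assume a: "lead_coeff a = 1"
        show "c * int (degree (carlitz_act a u)) =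
            D * int CARD('a) ^ degree a - (if a = 1 then \<epsilon> else 0)"
        proof (cases "degree u > 0")
          case True
          moreover have "a \<noteq> 0" using a by auto
          ultimately show ?thesis using degree_carlitz_act[OF assms(2) True, of a]
            by (simp add: c_def D_def \<epsilon>_def)
        next
          case False
          show ?thesis
          proof (cases "degree a > 0")
            case True
            hence "a \<noteq> 1" by auto
            moreover have "int CARD('a) ^ degree a = int CARD('a) * int CARD('a) ^ (degree a - 1)"
              using True by (metis Suc_pred' power_Suc)
            ultimately show ?thesis using False u1 degree_carlitz_act_1[OF assms(2) True]
              by (simp add: c_def D_def \<epsilon>_def q_def)
          next
            case False
            hence "a = 1" using a by (intro monic_degree_0_eq_1) auto
            thus ?thesis using u1 \<open>\<not> degree u > 0\<close> by (simp add: carlitz_act_1 c_def D_def \<epsilon>_def)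
          qed
        qed
      qed (use q4 in \<open>auto simp: c_def D_def \<epsilon>_def\<close>)
      moreover have fin: "finite S" unfolding S_def by (rule finite_monic_prime_divisors[OF m0(1)])
      have fac: "q ^ degree p - 1 \<ge> int (degree p) * (q - 1)" "q ^ degree p - 1 \<ge> 3"
        if "p \<in> S" for p
      proof -
        show *: "q ^ degree p - 1 \<ge> int (degree p) * (q - 1)" using q4 by (intro bernoulli_int) auto
        have "degree p > 0" using that monic_primeD(3) by (auto simp: S_def)
        hence "1 * 3 \<le> int (degree p) * (q - 1)" using q4 by (intro mult_mono) auto
        thus "q ^ degree p - 1 \<ge> 3" using * by linarith
      qed
      \<comment> \<open>All factors are at least \<open>3\<close>, so omitting some can only lower
        the product.\<close>
      have sub: "(\<Prod>p\<in>T. q ^ degree p - 1) \<le> \<Phi>" if "T \<subseteq> S" for T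
      proof -
        have "1 \<le> (\<Prod>p\<in>S - T. q ^ degree p - 1)" using fac(2) by (intro prod_ge_1) force
        moreover have "0 \<le> (\<Prod>p\<in>T. q ^ degree p - 1)" using fac(2) that by (intro prod_nonneg) force
        moreover have "\<Phi> = (\<Prod>p\<in>S - T. q ^ degree p - 1) * (\<Prod>p\<in>T. q ^ degree p - 1)"
          unfolding \<Phi>_def using prod.subset_diff[OF that fin] by blast
        ultimately show ?thesis using mult_right_mono by fastforce
      qed
      have "D \<ge> 1" by (auto simp: D_def)
      moreover have "\<Phi> \<ge> 1" using sub[of "{}"] by simp
      ultimately have bound: "\<Phi> - \<epsilon> \<le> c * (\<Sum>P\<in>I. int (degree P))"
        using mult_right_mono[of 1 D \<Phi>] by linarith
      have IS: "I \<subseteq> S" by (auto simp: I_def S_def intrinsic_prime_def)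
      have "degree m > 0" using m by simp
      then obtain p where "monic_prime p" "p dvd m" by (rule exists_monic_prime_dvd)
      hence p: "p \<in> S" by (simp add: S_def)
      show False
      proof (cases "I = {}")
        case True
        have "\<Phi> \<ge> 3" using sub[of "{p}"] fac(2)[OF p] p by simp
        thus False using bound True by (simp add: \<epsilon>_def split: if_splits)
      next
        case False
        then obtain P where P: "P \<in> I" by blast
        hence PS: "P \<in> S" using IS by blast
        have dP: "degree P \<ge> 1" using PS monic_primeD(3) by (force simp: S_def)
        show False
        proof (cases "I = {P}")
          case True
          show False
          proof (cases "degree u > 0")
            case True
            \<comment> \<open>Already the factor of \<open>P\<close> gives
              \<open>3 * degree P\<close>, above the permitted \<open>degree P\<close>.\<close>
            have "\<Phi> \<ge> int (degree P) * (q - 1)" using sub[of "{P}"] fac(1)[OF PS] PS by simp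
            moreover have "int (degree P) * 3 \<le> int (degree P) * (q - 1)"
              using q4 by (intro mult_left_mono) auto
            moreover have "\<Phi> \<le> int (degree P)"
              using bound \<open>I = {P}\<close> True by (simp add: c_def \<epsilon>_def)
            ultimately show False using dP by linarith
          next
            case u: False
            \<comment> \<open>\<open>n\<close> annihilates \<open>u = 1\<close> modulo
              \<open>P\<close>, which no nonzero constant does. Hence \<open>m\<close> has a prime
              factor \<open>r \<noteq> P\<close>, and \<open>\<Phi>\<close> gains a second factor of
              at least \<open>q - 1\<close>.\<close>
            obtain n where n: "n dvd m" "\<not> P dvd n" "P dvd carlitz_act n u"
              using intrinsic_prime_decompose[of u m P] P m0(1) unfolding I_def
              by (metis dvd_triv_right mem_Collect_eq)
            have "degree n > 0"
            proof (rule ccontr)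
              assume "\<not> degree n > 0"
              then obtain k where k: "n = [:k:]" by (metis degree_eq_zeroE gr0I)
              hence "k \<noteq> 0" using n(1) m0(1) by auto
              hence "P dvd 1" using n(3) u u1 by (simp add: k carlitz_act_const dvd_smult_iff)
              thus False using monic_primeD(5) PS by (auto simp: S_def)
            qed
            then obtain r where r: "monic_prime r" "r dvd n" by (rule exists_monic_prime_dvd)
            have rS: "r \<in> S" using r n(1) dvd_trans by (auto simp: S_def)
            have rP: "r \<noteq> P" using r n(2) by auto
            have dr: "degree r \<ge> 1" using monic_primeD(3)[OF r(1)] by simp
            have "(q - 1) * (int (degree P) * (q - 1)) \<le> (q ^ degree r - 1) * (q ^ degree P - 1)"
            proof (rule mult_mono)
              have "1 * (q - 1) \<le> int (degree r) * (q - 1)" using q4 dr by (intro mult_right_mono) auto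
              also note fac(1)[OF rS]
              finally show "q - 1 \<le> q ^ degree r - 1" by simp
            qed (use fac[OF PS] fac[OF rS] q4 in auto)
            also have "\<dots> \<le> \<Phi>" using sub[of "{r, P}"] rS PS rP by simp
            also have "\<Phi> \<le> q * int (degree P) + 1" using bound \<open>I = {P}\<close> u by (simp add: c_def \<epsilon>_def)
            finally have "int (degree P) * ((q - 1) * (q - 1) - q) \<le> 1" by (simp add: algebra_simps)
            \<comment> \<open>The minimum is attained at \<open>q = 4\<close>.\<close>
            moreover have "(q - 1) * (q - 1) - q \<ge> 5"
              using mult_mono[of 3 "q - 1" 3 "q - 1"] mult_mono[of 4 q 1 "q - 3"] q4
              by (simp add: algebra_simps)
            hence "1 * 5 \<le> int (degree P) * ((q - 1) * (q - 1) - q)" using dP by (intro mult_mono) auto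
            ultimately show False by linarith
          qed
        next
          case False
          then obtain R where R: "R \<in> I" "R \<noteq> P" using P by blast
          have two: "R' = P - 1 \<and> m = (P - 1) * P" if "R' \<in> I" "R' \<noteq> P" for R'
            using two_intrinsic_primes[of u m P R'] P that assms(3) by (auto simp: I_def)
          have "I = {P, P - 1}" and ne: "P - 1 \<noteq> P" using two R P by auto
          moreover have deg1: "degree (P - 1) = degree P" using dP by (intro lead_coeff_minus_1) simp
          ultimately have sum: "(\<Sum>P\<in>I. int (degree P)) = 2 * int (degree P)" by simp
          have "(q ^ degree P - 1)\<^sup>2 \<le> \<Phi>"
            using sub[OF IS] ne deg1 unfolding \<open>I = {P, P - 1}\<close> by (simp add: power2_eq_square)
          hence *: "(q ^ degree P - 1)\<^sup>2 - \<epsilon> \<le> c * (2 * int (degree P))"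
            using bound unfolding sum by linarith
          \<comment> \<open>The bound for nonconstant \<open>u\<close> is weakened to the one for
            \<open>u = 1\<close>, so that \<open>totient_bound\<close> serves both.\<close>
          have "(q ^ degree P - 1)\<^sup>2 - 1 \<le> q * (2 * int (degree P))"
          proof (cases "degree u > 0")
            case True
            have "1 * (2 * int (degree P)) \<le> q * (2 * int (degree P))"
              using q4 by (intro mult_right_mono) auto
            thus ?thesis using * True by (simp add: c_def \<epsilon>_def)
          qed (use * in \<open>simp add: c_def \<epsilon>_def\<close>)
          hence "q = 4" "degree P = 1" using totient_bound[OF q4 dP] by auto
          moreover have "u = 1"
          proof (rule ccontr)
            \<comment> \<open>Nonconstant \<open>u\<close> has the stronger bound, which would now
              read \<open>9 \<le> 2\<close>.\<close>
            assume "u \<noteq> 1"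
            hence "degree u > 0" using u1 by auto
            thus False using * \<open>q = 4\<close> \<open>degree P = 1\<close> by (simp add: c_def \<epsilon>_def)
          qed
          moreover have "prime_elem P" "lead_coeff P = 1" using PS monic_primeD(1,2) by (auto simp: S_def)
          moreover have "m = (P - 1) * P" using two R by blast
          ultimately show False using not_exceptional by (auto simp: q_def)
        qed
      qed
    qed
  qed
qed

end
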